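(* Let $\mathcal{A}$ be a central S-ring over a finite group $G$. Then $\mathcal{A}$ is rational if and only if $\pi(\underline{X})\in\mathbb{Q}$ for all $\pi\in\mathrm{Irr}(\mathcal{A})$ and all basic sets $X\in\mathcal{S}(\mathcal{A})$.
   Context: For a finite group $G$ with identity $e$ and $X\subseteq G$, write $\underline{X}=\sum_{x\in X}x\in\mathbb{Z}G$. A subring $\mathcal{A}$ of $\mathbb{Z}G$ is an S-ring over $G$ if there is a partition $\mathcal{S}(\mathcal{A})$ of $G$ (basic sets) such that $\{e\}\in\mathcal{S}(\mathcal{A})$, $X\in\mathcal{S}(\mathcal{A})\Rightarrow X^{-1}\in\mathcal{S}(\mathcal{A})$, and $\mathcal{A}$ is the $\mathbb{Z}$-span of $\{\underline{X}: X\in\mathcal{S}(\mathcal{A})\}$. $\mathcal{A}$ is central if $\mathcal{A}\subseteq\mathcal{Z}(\mathbb{Z}G)$; a central S-ring is commutative. $\mathrm{Irr}(\mathcal{A})$ denotes the set of irreducible complex characters of $\mathcal{A}$, i.e. the nonzero ring homomorphisms $\mathcal{A}\to\mathbb{C}$ (equivalently, the $\mathbb{C}$-algebra homomorphisms $\mathbb{C}\otimes\mathcal{A}\to\mathbb{C}$); they are exactly the maps $\frac{1}{\chi(1)}\chi|_{\mathcal{A}}$ for $\chi$ an irreducible complex character of $G$ extended linearly to $\mathbb{Z}G$. For an integer $m$, $X^{(m)}=\{x^m:x\in X\}$. A central S-ring $\mathcal{A}$ is rational if $X^{(m)}=X$ for every basic set $X$ of $\mathcal{A}$ and every integer $m$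 coprime to $|G|$. *)

theory Defs
  imports "HOL-Algebra.Algebra" "HOL-Library.Disjoint_Sets" Complex_Main
begin

definition grp_ring :: "('a, 'b) monoid_scheme \<Rightarrow> ('a \<Rightarrow> int) set" where
  "grp_ring G = {f. \<forall>x. x \<notin> carrier G \<longrightarrow> f x = 0}"

definition gr_mult :: "('a, 'b) monoid_scheme \<Rightarrow> ('a \<Rightarrow> int) \<Rightarrow> ('a \<Rightarrow> int) \<Rightarrow> ('a \<Rightarrow> int)" where
  "gr_mult G f g = (\<lambda>z. if z \<in> carrier G
      then (\<Sum>x\<in>carrier G. f x * g (inv\<^bsub>G\<^esub> x \<otimes>\<^bsub>G\<^esub> z)) else 0)"

definition ul :: "'a set \<Rightarrow> ('a \<Rightarrow> int)" where
  "ul Y = (\<lambda>z. if z \<in> Y then 1 else 0)"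

definition zspan :: "'a set set \<Rightarrow> ('a \<Rightarrow> int) set" where
  "zspan S = {f. \<exists>c :: 'a set \<Rightarrow> int. f = (\<lambda>z. \<Sum>Y\<in>S. c Y * ul Y z)}"

text \<open>S is the set of basic sets of an S-ring over G (the S-ring being zspan S):
a partition of G containing {e}, closed under inversion, whose Z-span is a subring
of ZG (it contains the identity ul {e} and is closed under addition automatically,
so closure under multiplication is what is required).\<close>
definition S_ring :: "('a, 'b) monoid_scheme \<Rightarrow> 'a set set \<Rightarrow> bool" where
  "S_ring G S \<longleftrightarrow> partition_on (carrier G) S
     \<and> {\<one>\<^bsub>G\<^esub>} \<in> S
     \<and> (\<forall>Y\<in>S. (\<lambda>x. inv\<^bsub>G\<^esub> x) ` Y \<in> S)
     \<and> (\<forall>a\<in>zspan S. \<forall>b\<in>zspan S. gr_mult G a b \<in> zspan S)"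

definition central :: "('a, 'b) monoid_scheme \<Rightarrow> 'a set set \<Rightarrow> bool" where
  "central G S \<longleftrightarrow> (\<forall>a\<in>zspan S. \<forall>f\<in>grp_ring G. gr_mult G a f = gr_mult G f a)"

text \<open>Irr(A): nonzero ring homomorphisms A \<rightarrow> C (only values on A matter).\<close>
definition Irr :: "('a, 'b) monoid_scheme \<Rightarrow> 'a set set \<Rightarrow> (('a \<Rightarrow> int) \<Rightarrow> complex) set" where
  "Irr G S = {\<pi>. (\<forall>a\<in>zspan S. \<forall>b\<in>zspan S. \<pi> (\<lambda>z. a z + b z) = \<pi> a + \<pi> b
                   \<and> \<pi> (gr_mult G a b) = \<pi> a * \<pi> b)
              \<and> (\<exists>a\<in>zspan S. \<pi> a \<noteq> 0)}"

definition rational_Sring :: "('a, 'b) monoid_scheme \<Rightarrow> 'a set set \<Rightarrow> bool" where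
  "rational_Sring G S \<longleftrightarrow> (\<forall>Y\<in>S. \<forall>m::int. coprime m (int (order G)) \<longrightarrow>
      (\<lambda>x. x [^]\<^bsub>G\<^esub> m) ` Y = Y)"

end

(* For a character pi let sph(w) = pi(Y)/|Y| for w in the basic set Y.  Then sph is a class function,
   the sum of sph(xw) over x in X is pi(X) sph(w), and sph * sph = tau sph for convolution, tau > 0.
   Rational S-ring => rational characters: multiplying the idempotent sph/tau by the averaging idempotent
   of a subgroup H and taking the trace shows that the sum of sph over H is rational.  For H cyclic, sph is
   constant on the generators of H, so induction on the order of w gives sph(w) rational.
   Rational characters => rational S-ring: pi(X)^p is the sum of sph over products of words of length p
   over X.  Rotating words and Fermat's theorem give sum sph(x^p) = sum sph(x) modulo p after clearing
   denominators, hence equality for large p, and a sum of squares yields sph(x^p) = sph(x).  Exponents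
   coprime to |G| can be replaced by congruent ones with only large prime factors, which avoids
   Dirichlet's theorem.  Since characters separate the elements of the S-ring, x and x^m lie in the
   same basic set. *)

theory Submission
  imports Defs "HOL-Number_Theory.Number_Theory" "HOL-Computational_Algebra.Fundamental_Theorem_Algebra"
begin

hide_const (open) Divisibility.prime
hide_const (open) Polynomial.order

section \<open>Arithmetic\<close>

text \<open>Three classical facts appear here in elementary form. Integrality of a rational value
  \<open>\<pi> (ul X)\<close> comes from bounded denominators: every power of it is a sum of values
  of \<open>sph\<close>, so one \<open>D\<close> clears the denominators of all powers at once. Only
  then can Fermat be applied to the value. Integrality of multiplicities becomes the statement that
  the trace of an idempotent matrix is a natural number; the trivial subgroup H yields that tau is
  rational, so tau can be removed from the sums over the other subgroups. Existence of enough
  characters comes from common eigenvectors of commuting translation operators, which are normal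
  because the S-ring is closed under inversion. The congruence modulo p compares only sums over
  whole basic sets. As \<open>sph\<close> is constant on basic sets, those sums determine the cross
  term in the sum of the squares of sph(x^p) - sph(x). As x -> x^p permutes the group, the two
  square terms agree as well, and a statement about averages becomes pointwise.\<close>

lemma coprime_lift_large_primes:
  fixes k n B :: nat
  assumes n: "n > 0" and cop: "coprime k n"
  obtains m where "m > 0" "[m = k] (mod n)" "\<And>p. prime p \<Longrightarrow> p dvd m \<Longrightarrow> p > B"
proof -
  \<comment> \<open>Primes dividing \<open>n\<close> cannot divide \<open>m\<close>, because
    \<open>m\<close> is congruent to the unit \<open>k\<close> modulo \<open>n\<close>. Only the
    other primes up to \<open>B\<close> have to be avoided, and the congruence to 1 modulo their
    product does that.\<close>
  define Q where "Q = {p. prime p \<and> p \<le> B \<and> \<not> p dvd n}"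
  have finQ: "finite Q" by (rule finite_subset[of _ "{..B}"]) (auto simp: Q_def)
  have "coprime n (\<Prod>Q)"
    by (rule prod_coprime_right) (metis (no_types, lifting) Q_def coprime_commute mem_Collect_eq prime_imp_coprime)
  then obtain m1 where m1: "[m1 = k] (mod n)" "[m1 = 1] (mod \<Prod>Q)"
    using binary_chinese_remainder_nat by metis
  \<comment> \<open>The Chinese remainder theorem may return 0; adding the full modulus makes the
    solution positive.\<close>
  define m0 where "m0 = m1 + n * \<Prod>Q"
  have m0: "[m0 = k] (mod n)" "[m0 = 1] (mod \<Prod>Q)"
    using m1 by (simp_all add: m0_def cong_def)
  have "\<Prod>Q > 0" by (rule prod_pos) (auto simp: Q_def prime_gt_0_nat)
  then have "m0 > 0" using n by (simp add: m0_def)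
  have big: "p > B" if p: "prime p" "p dvd m0" for p
  proof (rule ccontr)
    assume "\<not> p > B"
    show False
    proof (cases "p dvd n")
      case True
      then have "[m0 = k] (mod p)" using m0(1) cong_dvd_modulus_nat by blast
      then have "p dvd k" using p(2) cong_dvd_iff by blast
      then show False using cop True p(1) by (meson coprime_common_divisor not_prime_unit)
    next
      case False
      then have "p \<in> Q" using p \<open>\<not> p > B\<close> by (auto simp: Q_def)
      then have "p dvd \<Prod>Q" using dvd_prodI[OF finQ, of p id] by (simp add: id_def)
      then have "[m0 = 1] (mod p)" using m0(2) cong_dvd_modulus_nat by blast
      then have "p dvd 1" using p(2) cong_dvd_iff by blast
      then show False using p(1) by (simp add: not_prime_unit)
    qed
  qed
  show ?thesis by (rule that[OF \<open>m0 > 0\<close> m0(1) big])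
qed

text \<open>If \<open>b\<close> is the reduced denominator of \<open>q\<close>, then every power of
  \<open>b\<close> divides the fixed nonzero \<open>D\<close>, so \<open>b = 1\<close>. This
  replaces the fact that a rational algebraic integer is an integer.\<close>

lemma rational_power_bounded_denominator:
  fixes q :: "'a :: field_char_0" and D :: int
  assumes q: "q \<in> \<rat>" and D: "D \<noteq> 0" and pow: "\<And>k. of_int D * q ^ k \<in> \<int>"
  shows "q \<in> \<int>"
proof -
  obtain r where r: "q = of_rat r" using q by (elim Rats_cases)
  obtain a b where ab: "quotient_of r = (a, b)" by force
  have b: "b > 0" "coprime a b" "r = of_int a / of_int b"
    using quotient_of_denom_pos[OF ab] quotient_of_coprime[OF ab] quotient_of_div[OF ab] by auto
  have dvd: "b ^ k dvd D" for k
  proof -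
    obtain z where "of_int D * q ^ k = of_int z" using pow[of k] by (elim Ints_cases)
    then have "of_rat (of_int D * r ^ k) = (of_rat (of_int z) :: 'a)"
      by (simp add: r of_rat_mult of_rat_power)
    then have "of_int D * r ^ k = of_int z" by (simp only: of_rat_eq_iff)
    then have "rat_of_int (D * a ^ k) = of_int (z * b ^ k)"
      using b by (simp add: field_simps)
    then have "D * a ^ k = z * b ^ k" by (simp only: of_int_eq_iff)
    then have "b ^ k dvd D * a ^ k" by simp
    moreover have "coprime (b ^ k) (a ^ k)" using b(2) by (simp add: coprime_commute)
    ultimately show ?thesis by (simp add: coprime_dvd_mult_left_iff)
  qed
  have "b = 1"
  proof (rule ccontr)
    assume "b \<noteq> 1"
    then have "b \<ge> 2" using b(1) by linarith
    have "\<bar>D\<bar> \<ge> b ^ nat \<bar>D\<bar>" using dvd_imp_le_int[OF D dvd[of "nat \<bar>D\<bar>"]] b(1) by simp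
    moreover have "b ^ nat \<bar>D\<bar> \<ge> 2 ^ nat \<bar>D\<bar>" using \<open>b \<ge> 2\<close> by (simp add: power_mono)
    moreover have "int (nat \<bar>D\<bar>) < 2 ^ nat \<bar>D\<bar>" by (rule of_nat_less_two_power)
    ultimately show False by linarith
  qed
  then show ?thesis using b(3) r by simp
qed

lemma sum_rational: "(\<And>x. x \<in> A \<Longrightarrow> f x \<in> \<rat>) \<Longrightarrow> (\<Sum>x\<in>A. f x :: 'a :: field_char_0) \<in> \<rat>"
  by (induction A rule: infinite_finite_induct) auto

lemma common_denominator:
  assumes "finite A" and "\<And>x. x \<in> A \<Longrightarrow> f x \<in> (\<rat> :: 'a :: field_char_0 set)"
  obtains D :: int where "D > 0" "\<And>x. x \<in> A \<Longrightarrow> of_int D * f x \<in> \<int>"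
proof -
  have "\<exists>D :: int. D > 0 \<and> (\<forall>x\<in>A. of_int D * f x \<in> \<int>)"
    using assms
  proof (induction A rule: finite_induct)
    case empty
    show ?case by (rule exI[of _ 1]) simp
  next
    case (insert x A)
    then obtain D :: int where D: "D > 0" "\<forall>x\<in>A. of_int D * f x \<in> \<int>" by auto
    obtain r where r: "f x = of_rat r" using insert.prems by (meson Rats_cases insertI1)
    obtain a b where ab: "quotient_of r = (a, b)" by force
    have b: "b > 0" "r = of_int a / of_int b"
      using quotient_of_denom_pos[OF ab] quotient_of_div[OF ab] by auto
    have "of_int b * f x = of_int a" using b by (simp add: r of_rat_divide)
    then have "of_int (b * D) * f x = of_int (D * a)" by (simp add: mult_ac)
    then have "of_int (b * D) * f x \<in> \<int>" by (simp only: Ints_of_int)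
    moreover have "of_int (b * D) * f y \<in> \<int>" if "y \<in> A" for y
      using D(2) that by (simp add: mult.assoc)
    ultimately show ?case using b(1) D(1) by (intro exI[of _ "b * D"]) auto
  qed
  then show ?thesis using that by blast
qed

lemma fermat_int:
  fixes a :: int
  assumes p: "prime (p :: nat)"
  shows "[a ^ p = a] (mod int p)"
proof -
  define b where "b = nat (a mod int p)"
  have "p > 0" using p by (simp add: prime_gt_0_nat)
  then have ab: "[a = int b] (mod int p)" by (simp add: b_def cong_def)
  have "[b ^ p = b] (mod p)"
  proof (cases "p dvd b")
    case True
    then have "p dvd b ^ p" using \<open>p > 0\<close> by (meson dvd_power dvd_trans dvd_power_same)
    then show ?thesis using True by (simp add: cong_def mod_eq_0_iff_dvd)
  next
    case False
    have "[b ^ (p - 1) * b = 1 * b] (mod p)"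
      by (rule cong_scalar_right[OF fermat_theorem[OF p False]])
    then show ?thesis using \<open>p > 0\<close> by (simp add: power_eq_if mult.commute)
  qed
  then have "[int b ^ p = int b] (mod int p)" by (metis cong_int_iff of_nat_power)
  then show ?thesis using cong_pow[OF ab, of p] ab by (meson cong_sym cong_trans)
qed

section \<open>Orbits of prime length\<close>

text \<open>As \<open>p\<close> is prime, every orbit of \<open>f\<close> has length 1 or
  \<open>p\<close>; \<open>\<theta>\<close> is constant on orbits, so an orbit of length
  \<open>p\<close> contributes a multiple of \<open>p\<close>. The induction removes one such orbit
  at a time.\<close>

lemma sum_cong_fixed_points:
  fixes \<theta> :: "'a \<Rightarrow> int"
  assumes p: "prime p" and A: "finite A" "\<And>x. x \<in> A \<Longrightarrow> f x \<in> A"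
    and per: "\<And>x. x \<in> A \<Longrightarrow> (f ^^ p) x = x"
    and inv: "\<And>x. x \<in> A \<Longrightarrow> \<theta> (f x) = \<theta> x"
  shows "[(\<Sum>x\<in>A. \<theta> x) = (\<Sum>x | x \<in> A \<and> f x = x. \<theta> x)] (mod int p)"
  using A per inv
proof (induction "card A" arbitrary: A rule: less_induct)
  case less
  show ?case
  proof (cases "\<forall>x\<in>A. f x = x")
    case True
    then have "{x. x \<in> A \<and> f x = x} = A" by auto
    then show ?thesis by simp
  next
    case False
    then obtain a where a: "a \<in> A" "f a \<noteq> a" by auto
    have p0: "p > 0" using p by (simp add: prime_gt_0_nat)
    define Ob where "Ob = (\<lambda>i. (f ^^ i) a) ` {..<p}"
    have inA: "(f ^^ i) a \<in> A" for i by (induction i) (simp_all add: a less.prems(2))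
    have th: "\<theta> ((f ^^ i) a) = \<theta> a" for i by (induction i) (simp_all add: inA less.prems(4))
    have fixmult: "(f ^^ (p * k)) x = x" if "x \<in> A" for k x
      by (induction k) (simp_all add: funpow_add less.prems(3)[OF that])
    have modp: "(f ^^ i) a = (f ^^ (i mod p)) a" for i
    proof -
      have "(f ^^ i) a = (f ^^ (i mod p + p * (i div p))) a" by simp
      also have "\<dots> = (f ^^ (i mod p)) a" by (simp only: funpow_add o_apply fixmult[OF a(1)])
      finally show ?thesis .
    qed
    have inj: "inj_on (\<lambda>i. (f ^^ i) a) {..<p}"
    proof (rule linorder_inj_onI')
      fix i j assume ij: "i \<in> {..<p}" "j \<in> {..<p}" "i < j"
      show "(f ^^ i) a \<noteq> (f ^^ j) a"
      proof
        assume eq: "(f ^^ i) a = (f ^^ j) a"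
        have "(f ^^ (p - i)) ((f ^^ i) a) = (f ^^ (p - i)) ((f ^^ j) a)" using eq by simp
        then have "(f ^^ (p - i + i)) a = (f ^^ (p - i + j)) a" by (simp only: funpow_add o_apply)
        moreover have "p - i + j = p + (j - i)" "p - i + i = p" using ij by auto
        moreover have "(f ^^ (p + (j - i))) a = (f ^^ (j - i)) a"
          by (simp only: funpow_add o_apply less.prems(3)[OF inA])
        ultimately have d: "(f ^^ (j - i)) a = a"
          by (simp only: less.prems(3)[OF a(1)])
        have dk: "(f ^^ ((j - i) * k)) a = a" for k
          by (induction k) (simp_all add: funpow_add d)
        \<comment> \<open>A coincidence in the orbit gives \<open>a\<close> the period
          \<open>j - i\<close>. Inverting \<open>j - i\<close> modulo \<open>p\<close> then gives it
          the period 1, against the choice of \<open>a\<close>.\<close>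
        have "coprime (j - i) p"
          using p ij by (metis coprime_commute lessThan_iff less_imp_diff_less nat_dvd_not_less
              prime_imp_coprime zero_less_diff)
        then obtain k where "[(j - i) * k = 1] (mod p)"
          using cong_solve_coprime_nat[of "j - i" p] by auto
        then have k: "(j - i) * k mod p = 1" using prime_gt_1_nat[OF p] by (simp add: cong_def)
        have "f a = (f ^^ ((j - i) * k)) a" unfolding modp[of "(j - i) * k"] k by simp
        then show False using a(2) dk by metis
      qed
    qed
    have OA: "Ob \<subseteq> A" using inA by (auto simp: Ob_def)
    have fO: "f x \<in> Ob" if x: "x \<in> Ob" for x
    proof -
      obtain i where "x = (f ^^ i) a" using x unfolding Ob_def by blast
      then have "f x = (f ^^ Suc i) a" by simp
      then have "f x = (f ^^ (Suc i mod p)) a" by (simp only: modp[of "Suc i"])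
      then show ?thesis using p0 by (auto simp: Ob_def)
    qed
    \<comment> \<open>Closure of the orbit under preimages is what makes the complement
      \<open>A - Ob\<close> stable under \<open>f\<close>, as the induction hypothesis
      demands.\<close>
    have fO': "x \<in> Ob" if x: "x \<in> A" "f x \<in> Ob" for x
    proof -
      have "(f ^^ k) (f x) \<in> Ob" for k by (induction k) (simp_all add: x fO)
      moreover have "(f ^^ (p - 1)) (f x) = x"
        using less.prems(3)[OF x(1)] p0 by (metis Suc_diff_1 funpow_simps_right(2) o_apply)
      ultimately show ?thesis by metis
    qed
    have nofix: "f x \<noteq> x" if x: "x \<in> Ob" for x
    proof
      assume fx: "f x = x"
      obtain i where i: "x = (f ^^ i) a" "i < p" using x by (auto simp: Ob_def)
      have "(f ^^ k) x = x" for k by (induction k) (simp_all add: fx)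
      then have "(f ^^ (p - i)) ((f ^^ i) a) = x" using i by simp
      then have "(f ^^ (p - i + i)) a = x" by (simp only: funpow_add o_apply)
      moreover have "p - i + i = p" using i by simp
      ultimately have "a = x" by (simp only: less.prems(3)[OF a(1)])
      then show False using fx a(2) by simp
    qed
    have "card (A - Ob) < card A"
      by (rule psubset_card_mono[OF less.prems(1)]) (use a p0 in \<open>auto simp: Ob_def image_iff intro!: bexI[of _ 0]\<close>)
    then have IH: "[(\<Sum>x\<in>A - Ob. \<theta> x) = (\<Sum>x | x \<in> A - Ob \<and> f x = x. \<theta> x)] (mod int p)"
      by (rule less.hyps) (use less.prems fO' in auto)
    have "(\<Sum>x\<in>Ob. \<theta> x) = (\<Sum>i<p. \<theta> a)"
      unfolding Ob_def by (simp add: sum.reindex[OF inj] th)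
    then have O0: "[(\<Sum>x\<in>Ob. \<theta> x) = 0] (mod int p)" by (simp add: cong_def)
    have "(\<Sum>x\<in>A. \<theta> x) = (\<Sum>x\<in>A - Ob. \<theta> x) + (\<Sum>x\<in>Ob. \<theta> x)"
      using OA less.prems(1) by (rule sum.subset_diff)
    moreover have "{x. x \<in> A - Ob \<and> f x = x} = {x. x \<in> A \<and> f x = x}" using nofix by auto
    ultimately show ?thesis using cong_add[OF IH O0] by simp
  qed
qed

section \<open>Linear algebra\<close>

text \<open>Subtracting from an idempotent the rank one idempotent built from a nonzero column and a
  nonzero row leaves an idempotent with more vanishing rows and lowers the trace by one.\<close>

lemma trace_idempotent_Nats:
  fixes E :: "'i \<Rightarrow> 'i \<Rightarrow> 'a :: field"
  assumes fin: "finite I"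
    and idem: "\<And>x y. x \<in> I \<Longrightarrow> y \<in> I \<Longrightarrow> (\<Sum>z\<in>I. E x z * E z y) = E x y"
  shows "(\<Sum>x\<in>I. E x x) \<in> \<nat>"
  using idem
proof (induction "card {x\<in>I. \<exists>y\<in>I. E x y \<noteq> 0}" arbitrary: E rule: less_induct)
  case less
  show ?case
  proof (cases "\<forall>x\<in>I. \<forall>y\<in>I. E x y = 0")
    case True
    then show ?thesis by simp
  next
    case False
    then obtain i j where ij: "i \<in> I" "j \<in> I" "E i j \<noteq> 0" by auto
    define F where "F x y = E x y - E x j * E i y / E i j" for x y
    have sums: "(\<Sum>z\<in>I. F x z * F z y) = F x y" if x: "x \<in> I" and y: "y \<in> I" for x y
    proof -
      have "F x z * F z y = E x z * E z y - E x z * E z j * (E i y / E i j)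
          - E x j / E i j * (E i z * E z y) + E x j / E i j * (E i z * E z j) * (E i y / E i j)" for z
        by (simp add: F_def algebra_simps)
      then have "(\<Sum>z\<in>I. F x z * F z y) = (\<Sum>z\<in>I. E x z * E z y)
          - (\<Sum>z\<in>I. E x z * E z j) * (E i y / E i j)
          - E x j / E i j * (\<Sum>z\<in>I. E i z * E z y)
          + E x j / E i j * (\<Sum>z\<in>I. E i z * E z j) * (E i y / E i j)"
        by (simp only: sum.distrib sum_subtractf sum_distrib_left sum_distrib_right)
      also have "\<dots> = F x y"
        unfolding less.prems[OF x y] less.prems[OF x ij(2)] less.prems[OF ij(1) y]
          less.prems[OF ij(1,2)] F_def using ij by simp
      finally show ?thesis .
    qed
    have "{x\<in>I. \<exists>y\<in>I. F x y \<noteq> 0} \<subset> {x\<in>I. \<exists>y\<in>I. E x y \<noteq> 0}"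
    proof
      show "{x\<in>I. \<exists>y\<in>I. F x y \<noteq> 0} \<subseteq> {x\<in>I. \<exists>y\<in>I. E x y \<noteq> 0}"
        using ij by (auto simp: F_def) (metis divide_eq_0_iff mult_eq_0_iff)
      have "i \<in> {x\<in>I. \<exists>y\<in>I. E x y \<noteq> 0}" "i \<notin> {x\<in>I. \<exists>y\<in>I. F x y \<noteq> 0}"
        using ij by (auto simp: F_def)
      then show "{x\<in>I. \<exists>y\<in>I. F x y \<noteq> 0} \<noteq> {x\<in>I. \<exists>y\<in>I. E x y \<noteq> 0}" by blast
    qed
    then have "card {x\<in>I. \<exists>y\<in>I. F x y \<noteq> 0} < card {x\<in>I. \<exists>y\<in>I. E x y \<noteq> 0}"
      using fin by (intro psubset_card_mono) auto
    then have F: "(\<Sum>x\<in>I. F x x) \<in> \<nat>" using sums by (rule less.hyps)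
    have "(\<Sum>x\<in>I. F x x) = (\<Sum>x\<in>I. E x x) - (\<Sum>x\<in>I. E i x * E x j) / E i j"
      by (simp add: F_def sum_subtractf sum_divide_distrib mult.commute)
    also have "\<dots> = (\<Sum>x\<in>I. E x x) - 1" using ij less.prems by simp
    finally have "(\<Sum>x\<in>I. E x x) = (\<Sum>x\<in>I. F x x) + 1" by simp
    then show ?thesis using F by (simp only: Nats_add Nats_1)
  qed
qed

text \<open>Gaussian elimination: the pivot \<open>l\<close> clears coordinate \<open>i\<close> from
  the other vectors, and the coefficient \<open>- s\<close> of the pivot is chosen so that
  coordinate \<open>i\<close> of the combination vanishes too.\<close>

lemma linear_dependence:
  fixes c :: "'k \<Rightarrow> 'i \<Rightarrow> 'a :: field"
  assumes "finite I" "finite K" "card I < card K"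
  obtains \<alpha> where "\<exists>k\<in>K. \<alpha> k \<noteq> 0" "\<And>i. i \<in> I \<Longrightarrow> (\<Sum>k\<in>K. \<alpha> k * c k i) = 0"
proof -
  have "\<exists>\<alpha>. (\<exists>k\<in>K. \<alpha> k \<noteq> 0) \<and> (\<forall>i\<in>I. (\<Sum>k\<in>K. \<alpha> k * c k i) = 0)"
    using assms
  proof (induction I arbitrary: K c rule: finite_induct)
    case empty
    then have "K \<noteq> {}" by auto
    then show ?case by (intro exI[of _ "\<lambda>_. 1"]) auto
  next
    case (insert i I)
    show ?case
    proof (cases "\<forall>k\<in>K. c k i = 0")
      case True
      then show ?thesis using insert.IH[of K c] insert.prems insert.hyps by force
    next
      case False
      then obtain l where l: "l \<in> K" "c l i \<noteq> 0" by auto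
      have "card I < card (K - {l})" using insert l by simp
      then obtain \<alpha> where \<alpha>: "\<exists>k\<in>K - {l}. \<alpha> k \<noteq> 0"
        "\<And>i'. i' \<in> I \<Longrightarrow> (\<Sum>k\<in>K - {l}. \<alpha> k * (c k i' - c k i / c l i * c l i')) = 0"
        using insert.IH[of "K - {l}" "\<lambda>k i'. c k i' - c k i / c l i * c l i'"] insert.prems by auto
      define s where "s = (\<Sum>k\<in>K - {l}. \<alpha> k * c k i) / c l i"
      define \<beta> where "\<beta> = \<alpha>(l := - s)"
      have eq: "(\<Sum>k\<in>K. \<beta> k * c k i') = (\<Sum>k\<in>K - {l}. \<alpha> k * c k i') - s * c l i'" for i'
      proof -
        have "(\<Sum>k\<in>K - {l}. \<beta> k * c k i') = (\<Sum>k\<in>K - {l}. \<alpha> k * c k i')"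
          by (rule sum.cong) (auto simp: \<beta>_def)
        then show ?thesis using sum.remove[OF insert.prems(1) l(1), of "\<lambda>k. \<beta> k * c k i'"]
          by (simp add: \<beta>_def)
      qed
      have "(\<Sum>k\<in>K. \<beta> k * c k i') = 0" if "i' \<in> I" for i'
      proof -
        have "s * c l i' = (\<Sum>k\<in>K - {l}. \<alpha> k * (c k i / c l i * c l i'))"
          by (simp add: s_def sum_divide_distrib sum_distrib_right mult.assoc)
        then show ?thesis using \<alpha>(2)[OF that] unfolding eq
          by (simp only: right_diff_distrib sum_subtractf)
      qed
      moreover have "(\<Sum>k\<in>K. \<beta> k * c k i) = 0" unfolding eq using l by (simp add: s_def)
      moreover have "\<exists>k\<in>K. \<beta> k \<noteq> 0" using \<alpha>(1) by (auto simp: \<beta>_def)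
      ultimately show ?thesis by auto
    qed
  qed
  then show ?thesis using that by blast
qed

section \<open>Common eigenvectors of commuting operators\<close>

locale linear_operator =
  fixes T :: "('i \<Rightarrow> complex) \<Rightarrow> 'i \<Rightarrow> complex"
  assumes add: "T (\<lambda>x. f x + g x) = (\<lambda>x. T f x + T g x)"
    and scale: "T (\<lambda>x. c * f x) = (\<lambda>x. c * T f x)"
begin

lemma zero: "T (\<lambda>x. 0) = (\<lambda>x. 0)"
  using scale[of 0 "\<lambda>x. 0"] by simp

lemma sum:
  assumes "finite K"
  shows "T (\<lambda>x. \<Sum>k\<in>K. c k * h k x) = (\<lambda>x. \<Sum>k\<in>K. c k * T (h k) x)"
  using assms by (induction K rule: finite_induct) (simp_all add: zero add scale)

end

locale function_subspace =
  fixes V :: "('i \<Rightarrow> complex) set"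
  assumes add: "f \<in> V \<Longrightarrow> g \<in> V \<Longrightarrow> (\<lambda>x. f x + g x) \<in> V"
    and scale: "f \<in> V \<Longrightarrow> (\<lambda>x. c * f x) \<in> V"
    and zero: "(\<lambda>x. 0) \<in> V"
begin

lemma sum:
  assumes "finite K" "\<And>k. k \<in> K \<Longrightarrow> h k \<in> V"
  shows "(\<lambda>x. \<Sum>k\<in>K. c k * h k x) \<in> V"
  using assms by (induction K rule: finite_induct) (simp_all add: zero add scale)

text \<open>Split off a root: q = (X - \<mu>) r and g = r(T) f, so (T - \<mu>) g = q(T) f = 0.
  Either \<open>g\<close> is an eigenvector, or \<open>r\<close> annihilates \<open>f\<close> and
  has smaller degree.\<close>

lemma eigenvector_of_annihilating_poly:
  assumes T: "linear_operator T" and TV: "\<And>f. f \<in> V \<Longrightarrow> T f \<in> V"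
    and f: "f \<in> V" "f \<noteq> (\<lambda>x. 0)"
    and q: "q \<noteq> 0" "\<And>x. (\<Sum>k\<le>degree q. coeff q k * (T ^^ k) f x) = 0"
  shows "\<exists>g\<in>V. g \<noteq> (\<lambda>x. 0) \<and> (\<exists>\<mu>. T g = (\<lambda>x. \<mu> * g x))"
  using q
proof (induction "degree q" arbitrary: q)
  case 0
  then have "coeff q 0 \<noteq> 0" by (metis leading_coeff_0_iff)
  with 0 have "f x = 0" for x using "0.prems"(2)[of x] by (simp flip: "0.hyps")
  then show ?case using f by auto
next
  case (Suc n)
  interpret linear_operator T by (rule T)
  have "\<not> constant (poly q)" using Suc.hyps(2) by (simp add: constant_degree)
  then obtain \<mu> where "poly q \<mu> = 0" using fundamental_theorem_of_algebra by blast
  then obtain r where r: "q = [:- \<mu>, 1:] * r" by (auto simp: poly_eq_0_iff_dvd)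
  have "r \<noteq> 0" using r Suc.prems(1) by auto
  then have deg: "degree r = n" using Suc.hyps(2) degree_mult_eq[of "[:- \<mu>, 1:]" r] r by (simp del: mult_pCons_left)
  have Tk: "(T ^^ k) f \<in> V" for k by (induction k) (simp_all add: f TV)
  define g where "g = (\<lambda>x. \<Sum>k\<le>n. coeff r k * (T ^^ k) f x)"
  have gV: "g \<in> V" unfolding g_def by (rule function_subspace.sum[OF function_subspace_axioms]) (simp_all add: Tk)
  have "T g x - \<mu> * g x = 0" for x
  proof -
    \<comment> \<open>The vanishing extra coefficient lets the sum for \<open>g\<close> run to
      \<open>Suc n\<close>, so that it can be compared termwise with the shifted sum for
      \<open>q\<close>.\<close>
    have top: "coeff r (Suc n) = 0" using deg by (simp add: coeff_eq_0)
    have q0: "coeff q 0 = - \<mu> * coeff r 0" and qS: "coeff q (Suc k) = coeff r k - \<mu> * coeff r (Suc k)" for k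
      by (simp_all add: r)
    have "g x = (\<Sum>k\<le>Suc n. coeff r k * (T ^^ k) f x)" by (simp add: g_def top)
    also have "\<dots> = coeff r 0 * f x + (\<Sum>k\<le>n. coeff r (Suc k) * T ((T ^^ k) f) x)"
      by (simp only: sum.atMost_Suc_shift funpow.simps id_apply o_apply)
    finally have gx: "g x = \<dots>" .
    have Tgx: "T g x = (\<Sum>k\<le>n. coeff r k * T ((T ^^ k) f) x)"
      unfolding g_def by (subst sum) simp_all
    have "0 = (\<Sum>k\<le>Suc n. coeff q k * (T ^^ k) f x)" using Suc.prems(2)[of x] Suc.hyps(2) by simp
    also have "\<dots> = coeff q 0 * f x + (\<Sum>k\<le>n. coeff q (Suc k) * T ((T ^^ k) f) x)"
      by (simp only: sum.atMost_Suc_shift funpow.simps id_apply o_apply)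
    also have "\<dots> = T g x - \<mu> * g x"
      unfolding gx Tgx q0 qS by (simp add: algebra_simps sum_subtractf sum_distrib_left)
    finally show ?thesis by simp
  qed
  then have eig: "T g = (\<lambda>x. \<mu> * g x)" by (intro ext) simp
  show ?case
  proof (cases "g = (\<lambda>x. 0)")
    case True
    then have "(\<Sum>k\<le>degree r. coeff r k * (T ^^ k) f x) = 0" for x
      using deg by (metis g_def)
    then show ?thesis using Suc.hyps(1)[OF deg[symmetric] \<open>r \<noteq> 0\<close>] by simp
  next
    case False
    then show ?thesis using gV eig by blast
  qed
qed

text \<open>All functions in \<open>V\<close> live on \<open>I\<close>, so the card I + 1 iterates
  of \<open>T\<close> on \<open>f\<close>, starting with \<open>f\<close> itself, are linearly
  dependent; a dependence is an annihilating polynomial.\<close>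

lemma eigenvector_exists:
  assumes T: "linear_operator T" and TV: "\<And>f. f \<in> V \<Longrightarrow> T f \<in> V"
    and supp: "finite I" "\<And>f x. f \<in> V \<Longrightarrow> x \<notin> I \<Longrightarrow> f x = 0"
    and f: "f \<in> V" "f \<noteq> (\<lambda>x. 0)"
  shows "\<exists>g\<in>V. g \<noteq> (\<lambda>x. 0) \<and> (\<exists>\<mu>. T g = (\<lambda>x. \<mu> * g x))"
proof -
  have Tk: "(T ^^ k) f \<in> V" for k by (induction k) (simp_all add: f TV)
  define N where "N = card I"
  have "card I < card {..N}" by (simp add: N_def)
  then obtain \<alpha> where \<alpha>: "\<exists>k\<in>{..N}. \<alpha> k \<noteq> 0"
    "\<And>x. x \<in> I \<Longrightarrow> (\<Sum>k\<le>N. \<alpha> k * (T ^^ k) f x) = 0"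
    using linear_dependence[OF supp(1) finite_atMost, of N "\<lambda>k. (T ^^ k) f"] by blast
  define q where "q = (\<Sum>k\<le>N. monom (\<alpha> k) k)"
  have coeff: "coeff q k = (if k \<le> N then \<alpha> k else 0)" for k
    by (simp add: q_def coeff_sum)
  have "q \<noteq> 0" using \<alpha>(1) coeff by (metis atMost_iff coeff_0)
  have deg: "degree q \<le> N" by (rule degree_le) (simp add: coeff)
  have "(\<Sum>k\<le>degree q. coeff q k * (T ^^ k) f x) = 0" for x
  proof -
    have "(\<Sum>k\<le>degree q. coeff q k * (T ^^ k) f x) = (\<Sum>k\<le>N. coeff q k * (T ^^ k) f x)"
      by (rule sum.mono_neutral_left) (use deg in \<open>auto simp: coeff_eq_0\<close>)
    also have "\<dots> = (\<Sum>k\<le>N. \<alpha> k * (T ^^ k) f x)" by (simp add: coeff)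
    also have "\<dots> = 0" using \<alpha>(2)[of x] supp(2)[OF Tk] by (cases "x \<in> I") auto
    finally show ?thesis .
  qed
  then show ?thesis
    by (intro eigenvector_of_annihilating_poly[OF T _ f \<open>q \<noteq> 0\<close>]) (simp_all add: TV)
qed

end

text \<open>Within \<open>V\<close>, an eigenspace of one operator is nonzero and, by commutation,
  invariant under the others. The induction continues inside it, which is why the subspace is a
  variable of the statement.\<close>

lemma common_eigenvector:
  assumes "finite J"
    and "\<And>j. j \<in> J \<Longrightarrow> linear_operator (T j)"
    and "\<And>j f. j \<in> J \<Longrightarrow> f \<in> V \<Longrightarrow> T j f \<in> V"
    and "\<And>j k f. j \<in> J \<Longrightarrow> k \<in> J \<Longrightarrow> f \<in> V \<Longrightarrow> T j (T k f) = T k (T j f)"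
    and "function_subspace V" "finite I" "\<And>f x. f \<in> V \<Longrightarrow> x \<notin> I \<Longrightarrow> f x = 0"
    and "f \<in> V" "f \<noteq> (\<lambda>x. 0)"
  shows "\<exists>g\<in>V. g \<noteq> (\<lambda>x. 0) \<and> (\<forall>j\<in>J. \<exists>\<mu>. T j g = (\<lambda>x. \<mu> * g x))"
  using assms
proof (induction J arbitrary: V f rule: finite_induct)
  case empty
  then show ?case by auto
next
  case (insert j J)
  interpret Tj: linear_operator "T j" by (rule insert.prems) simp
  interpret V: function_subspace V by (rule insert.prems)
  obtain g \<mu> where g: "g \<in> V" "g \<noteq> (\<lambda>x. 0)" "T j g = (\<lambda>x. \<mu> * g x)"
    using V.eigenvector_exists[of "T j" I f] Tj.linear_operator_axioms insert.prems by blast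
  define W where "W = {h \<in> V. T j h = (\<lambda>x. \<mu> * h x)}"
  have W: "function_subspace W"
    by unfold_locales (auto simp: W_def V.add V.scale V.zero Tj.add Tj.scale Tj.zero algebra_simps)
  have TW: "T k h \<in> W" if "k \<in> J" "h \<in> W" for k h
  proof -
    interpret Tk: linear_operator "T k" using insert.prems(1) that by simp
    show ?thesis
      using that insert.prems(2)[of k h] insert.prems(3)[of j k h] by (auto simp: W_def Tk.scale)
  qed
  have "\<exists>g\<in>W. g \<noteq> (\<lambda>x. 0) \<and> (\<forall>j\<in>J. \<exists>\<mu>. T j g = (\<lambda>x. \<mu> * g x))"
    by (rule insert.IH[of W g]) (use insert.prems TW W g in \<open>auto simp: W_def\<close>)
  then show ?case by (auto simp: W_def)
qed

section \<open>Spherical functions\<close>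

context group
begin

lemma sum_carrier_inv: "(\<Sum>x\<in>carrier G. f (inv x)) = (\<Sum>x\<in>carrier G. f x)"
  by (rule sum.reindex_bij_witness[of _ "\<lambda>x. inv x" "\<lambda>x. inv x"]) auto

lemma sum_carrier_mult_left:
  "g \<in> carrier G \<Longrightarrow> (\<Sum>x\<in>carrier G. f (g \<otimes> x)) = (\<Sum>x\<in>carrier G. f x)"
  by (rule sum.reindex_bij_witness[of _ "\<lambda>x. inv g \<otimes> x" "\<lambda>x. g \<otimes> x"]) (auto simp: m_assoc[symmetric])

lemma sum_carrier_mult_right:
  "g \<in> carrier G \<Longrightarrow> (\<Sum>x\<in>carrier G. f (x \<otimes> g)) = (\<Sum>x\<in>carrier G. f x)"
  by (rule sum.reindex_bij_witness[of _ "\<lambda>x. x \<otimes> inv g" "\<lambda>x. x \<otimes> g"]) (auto simp: m_assoc)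

end

locale central_S_ring = group G for G (structure) +
  fixes S :: "'a set set"
  assumes fin: "finite (carrier G)" and sring: "S_ring G S" and cen: "central G S"
begin

lemma part: "partition_on (carrier G) S"
  using sring by (simp add: S_ring_def)

lemma finite_S: "finite S"
  using finite_elements[OF fin part] .

lemma block_subset: "Y \<in> S \<Longrightarrow> Y \<subseteq> carrier G"
  using partition_onD1[OF part] by auto

lemma finite_block: "Y \<in> S \<Longrightarrow> finite Y"
  using block_subset fin finite_subset by blast

lemma block_nonempty: "Y \<in> S \<Longrightarrow> Y \<noteq> {}"
  using partition_onD3[OF part] by auto

lemma card_block_pos: "Y \<in> S \<Longrightarrow> card Y > 0"
  using finite_block block_nonempty by (simp add: card_gt_0_iff)

lemma block_exists: "x \<in> carrier G \<Longrightarrow> \<exists>Y\<in>S. x \<in> Y"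
  using partition_onD1[OF part] by auto

lemma block_unique: "Y \<in> S \<Longrightarrow> Z \<in> S \<Longrightarrow> x \<in> Y \<Longrightarrow> x \<in> Z \<Longrightarrow> Y = Z"
  using partition_onD2[OF part] by (auto dest: disjointD)

lemma sum_carrier_blocks: "(\<Sum>x\<in>carrier G. f x) = (\<Sum>Y\<in>S. \<Sum>x\<in>Y. f x)"
proof -
  have "(\<Sum>x\<in>\<Union>S. f x) = (\<Sum>Y\<in>S. \<Sum>x\<in>Y. f x)"
    using finite_block block_unique by (subst sum.Union_disjoint) auto
  then show ?thesis using partition_onD1[OF part] by simp
qed

lemma sum_ul_block:
  assumes "Y \<in> S"
  shows "(\<Sum>x\<in>carrier G. of_int (ul Y x) * f x) = (\<Sum>x\<in>Y. f x :: 'c :: ring_1)"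
proof -
  have "(\<Sum>x\<in>carrier G. of_int (ul Y x) * f x) = (\<Sum>x\<in>Y. of_int (ul Y x) * f x)"
    using fin block_subset[OF assms] by (intro sum.mono_neutral_right) (auto simp: ul_def)
  then show ?thesis by (simp add: ul_def)
qed

lemma sum_ul_at:
  assumes "Y \<in> S" "w \<in> Y"
  shows "(\<Sum>Z\<in>S. c Z * of_int (ul Z w)) = (c Y :: 'c :: ring_1)"
proof -
  have "w \<in> Z \<longleftrightarrow> Z = Y" if "Z \<in> S" for Z using assms block_unique that by blast
  then have "(\<Sum>Z\<in>S. c Z * of_int (ul Z w)) = (\<Sum>Z\<in>S. if Z = Y then c Y else 0)"
    by (intro sum.cong) (simp_all add: ul_def)
  then show ?thesis using assms finite_S by simp
qed

text \<open>Turns the existence of coefficients into pointwise conditions. The use made of it most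
  often is that a product of elements of the S-ring takes equal values at all points of a basic
  set.\<close>

lemma zspan_iff:
  "a \<in> zspan S \<longleftrightarrow> (\<forall>x. x \<notin> carrier G \<longrightarrow> a x = 0) \<and> (\<forall>Y\<in>S. \<forall>x\<in>Y. \<forall>y\<in>Y. a x = a y)"
  (is "_ \<longleftrightarrow> ?R")
proof
  assume "a \<in> zspan S"
  then obtain c where c: "a = (\<lambda>z. \<Sum>Y\<in>S. c Y * ul Y z)" by (auto simp: zspan_def)
  have "a x = 0" if "x \<notin> carrier G" for x
    unfolding c using that block_subset by (intro sum.neutral) (auto simp: ul_def)
  moreover have "a x = c Y" if "Y \<in> S" "x \<in> Y" for x Y
    unfolding c using sum_ul_at[OF that, of c] by simp
  ultimately show ?R by simp
next
  assume R: ?R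
  have "a z = (\<Sum>Y\<in>S. a (SOME x. x \<in> Y) * ul Y z)" for z
  proof (cases "z \<in> carrier G")
    case True
    then obtain Y where Y: "Y \<in> S" "z \<in> Y" using block_exists by auto
    then have "(SOME x. x \<in> Y) \<in> Y" by (metis someI)
    then have "a (SOME x. x \<in> Y) = a z" using R Y by blast
    then show ?thesis using sum_ul_at[OF Y, of "\<lambda>Y. a (SOME x. x \<in> Y)"] by simp
  next
    case False
    then have "(\<Sum>Y\<in>S. a (SOME x. x \<in> Y) * ul Y z) = 0"
      using block_subset by (intro sum.neutral) (auto simp: ul_def)
    then show ?thesis using R False by simp
  qed
  then show "a \<in> zspan S" unfolding zspan_def mem_Collect_eq
    by (intro exI[of _ "\<lambda>Y. a (SOME x. x \<in> Y)"] ext)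
qed

lemma zspan_const: "a \<in> zspan S \<Longrightarrow> Y \<in> S \<Longrightarrow> x \<in> Y \<Longrightarrow> y \<in> Y \<Longrightarrow> a x = a y"
  using zspan_iff[THEN iffD1, of a] by blast

lemma zspan_outside: "a \<in> zspan S \<Longrightarrow> x \<notin> carrier G \<Longrightarrow> a x = 0"
  using zspan_iff[THEN iffD1, of a] by blast

lemma zspan_zero: "(\<lambda>z. 0) \<in> zspan S"
  by (simp add: zspan_iff)

lemma zspan_add: "a \<in> zspan S \<Longrightarrow> b \<in> zspan S \<Longrightarrow> (\<lambda>z. a z + b z) \<in> zspan S"
  unfolding zspan_iff by (metis add_0)

lemma zspan_scale: "a \<in> zspan S \<Longrightarrow> (\<lambda>z. c * a z) \<in> zspan S"
  unfolding zspan_iff by (metis mult_zero_right)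

lemma ul_zspan:
  assumes "Y \<in> S"
  shows "ul Y \<in> zspan S"
proof -
  have "x \<in> Y \<longleftrightarrow> y \<in> Y" if "Z \<in> S" "x \<in> Z" "y \<in> Z" for Z x y
    using assms block_unique that by blast
  moreover have "x \<notin> Y" if "x \<notin> carrier G" for x using that block_subset[OF assms] by blast
  ultimately show ?thesis unfolding zspan_iff ul_def by metis
qed

lemma mult_zspan: "a \<in> zspan S \<Longrightarrow> b \<in> zspan S \<Longrightarrow> gr_mult G a b \<in> zspan S"
  using sring by (simp add: S_ring_def)

lemma inv_block: "Y \<in> S \<Longrightarrow> (\<lambda>x. inv x) ` Y \<in> S"
  using sring by (simp add: S_ring_def)

text \<open>The involution of the group ring that inverts group elements; it yields the adjoint
  operator for the inner product on functions on the group.\<close>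

definition star :: "('a \<Rightarrow> int) \<Rightarrow> 'a \<Rightarrow> int" where
  "star a = (\<lambda>x. if x \<in> carrier G then a (inv x) else 0)"

lemma star_zspan:
  assumes a: "a \<in> zspan S"
  shows "star a \<in> zspan S"
  unfolding zspan_iff
proof (intro conjI allI impI ballI)
  fix Y x y assume Y: "Y \<in> S" "x \<in> Y" "y \<in> Y"
  then have "a (inv x) = a (inv y)" by (intro zspan_const[OF a inv_block[OF Y(1)]]) auto
  then show "star a x = star a y" using Y block_subset[OF Y(1)] by (auto simp: star_def)
qed (simp add: star_def)

lemma gr_mult_star: "w \<in> carrier G \<Longrightarrow> gr_mult G (star a) b w = (\<Sum>x\<in>carrier G. a x * b (x \<otimes> w))"
  using sum_carrier_inv[of "\<lambda>x. a x * b (x \<otimes> w)"] by (simp add: gr_mult_def star_def)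

text \<open>Commutation of \<open>a\<close> with the single group element \<open>x\<close>, read off
  at the coefficient of \<open>x \<otimes> y \<otimes> x\<close>: one product has the coefficient
  \<open>a (y \<otimes> x)\<close> there, the other \<open>a (x \<otimes> y)\<close>.\<close>

lemma central_conj:
  assumes a: "a \<in> zspan S" and x: "x \<in> carrier G" and y: "y \<in> carrier G"
  shows "a (x \<otimes> y) = a (y \<otimes> x)"
proof -
  have \<delta>: "ul {x} \<in> grp_ring G" using x by (simp add: grp_ring_def ul_def)
  define z where "z = x \<otimes> y \<otimes> x"
  have z: "z \<in> carrier G" using x y by (simp add: z_def)
  have "gr_mult G (ul {x}) a z = (\<Sum>u\<in>carrier G. if u = x then a (inv x \<otimes> z) else 0)"
    using z by (auto simp: gr_mult_def ul_def intro!: sum.cong)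
  then have 1: "gr_mult G (ul {x}) a z = a (y \<otimes> x)"
    using fin x y by (simp add: z_def m_assoc) (simp add: m_assoc[symmetric])
  have "gr_mult G a (ul {x}) z = (\<Sum>u\<in>carrier G. if u = x \<otimes> y then a (x \<otimes> y) else 0)"
  proof -
    have "inv u \<otimes> z = x \<longleftrightarrow> u = x \<otimes> y" if u: "u \<in> carrier G" for u
    proof -
      have "inv u \<otimes> z = x \<longleftrightarrow> z = u \<otimes> x" using u x z by (metis inv_solve_left inv_closed m_closed)
      also have "\<dots> \<longleftrightarrow> x \<otimes> y = u" unfolding z_def using u x y by (simp add: r_cancel)
      finally show ?thesis by auto
    qed
    then show ?thesis using z by (auto simp: gr_mult_def ul_def intro!: sum.cong)
  qed
  then have 2: "gr_mult G a (ul {x}) z = a (x \<otimes> y)" using fin x y by simp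
  have "gr_mult G a (ul {x}) = gr_mult G (ul {x}) a" using cen a \<delta> unfolding central_def by blast
  then show ?thesis using 1 2 by metis
qed

lemma gr_mult_commute: "a \<in> zspan S \<Longrightarrow> b \<in> zspan S \<Longrightarrow> gr_mult G a b = gr_mult G b a"
  using cen by (simp add: central_def grp_ring_def zspan_outside)

end

section \<open>The spherical function of a character\<close>

locale S_ring_character = central_S_ring +
  fixes \<pi> assumes Irr: "\<pi> \<in> Irr G S"
begin

lemma pi_add: "a \<in> zspan S \<Longrightarrow> b \<in> zspan S \<Longrightarrow> \<pi> (\<lambda>z. a z + b z) = \<pi> a + \<pi> b"
  and pi_mult: "a \<in> zspan S \<Longrightarrow> b \<in> zspan S \<Longrightarrow> \<pi> (gr_mult G a b) = \<pi> a * \<pi> b"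
  and pi_nonzero: "\<exists>a\<in>zspan S. \<pi> a \<noteq> 0"
  using Irr by (auto simp: Irr_def)

lemma pi_zero: "\<pi> (\<lambda>z. 0) = 0"
  using pi_add[OF zspan_zero zspan_zero] by simp

lemma pi_scale:
  assumes a: "a \<in> zspan S"
  shows "\<pi> (\<lambda>z. c * a z) = of_int c * \<pi> a"
proof -
  have za: "(\<lambda>z. c * a z) \<in> zspan S" for c :: int
    using a by (rule zspan_scale)
  have nat: "\<pi> (\<lambda>z. int n * a z) = of_nat n * \<pi> a" for n
  proof (induction n)
    case (Suc n)
    then show ?case using pi_add[OF a za[of "int n"]] by (simp add: algebra_simps)
  qed (simp add: pi_zero)
  have "\<pi> (\<lambda>z. c * a z) + \<pi> (\<lambda>z. - c * a z) = 0"
    using pi_add[OF za[of c] za[of "- c"]] by (simp add: pi_zero)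
  then show ?thesis
    using nat[of "nat c"] nat[of "nat (- c)"] by (cases "c \<ge> 0") (auto simp: add_eq_0_iff)
qed

lemma pi_combination:
  "\<pi> (\<lambda>z. \<Sum>Y\<in>S. c Y * ul Y z) = (\<Sum>Y\<in>S. of_int (c Y) * \<pi> (ul Y))"
proof -
  have "(\<lambda>z. \<Sum>Y\<in>T. c Y * ul Y z) \<in> zspan S \<and>
      \<pi> (\<lambda>z. \<Sum>Y\<in>T. c Y * ul Y z) = (\<Sum>Y\<in>T. of_int (c Y) * \<pi> (ul Y))" if "T \<subseteq> S" for T
    using finite_subset[OF that finite_S] that
  proof (induction T rule: finite_induct)
    case (insert Y T)
    have Y: "(\<lambda>z. c Y * ul Y z) \<in> zspan S"
      using insert.prems by (intro zspan_scale ul_zspan) simp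
    then have "(\<lambda>z. c Y * ul Y z + (\<Sum>Y\<in>T. c Y * ul Y z)) \<in> zspan S"
      using insert.IH insert.prems by (intro zspan_add) auto
    then show ?case
      using insert Y by (simp add: pi_add pi_scale ul_zspan)
  qed (simp add: pi_zero zspan_zero)
  then show ?thesis by blast
qed

text \<open>The sum over all basic sets avoids choosing the one that contains \<open>w\<close>, and
  gives 0 outside the group. The complex conjugate of \<open>sph\<close>, divided by tau, is the
  coefficient function of the primitive idempotent belonging to \<open>\<pi>\<close>.\<close>

definition sph :: "'a \<Rightarrow> complex" where
  "sph w = (\<Sum>Y\<in>S. \<pi> (ul Y) / of_nat (card Y) * of_int (ul Y w))"

lemma sph_block: "Y \<in> S \<Longrightarrow> w \<in> Y \<Longrightarrow> sph w = \<pi> (ul Y) / of_nat (card Y)"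
  unfolding sph_def by (rule sum_ul_at)

lemma pi_ul:
  assumes "Y \<in> S"
  shows "(\<Sum>w\<in>Y. sph w) = \<pi> (ul Y)"
proof -
  have "(\<Sum>w\<in>Y. sph w) = (\<Sum>w\<in>Y. \<pi> (ul Y) / of_nat (card Y))"
    by (rule sum.cong) (use assms sph_block in auto)
  then show ?thesis using card_block_pos[OF assms] by simp
qed

lemma pi_eq_sum:
  assumes "a \<in> zspan S"
  shows "\<pi> a = (\<Sum>w\<in>carrier G. of_int (a w) * sph w)"
proof -
  obtain c where c: "a = (\<lambda>z. \<Sum>Y\<in>S. c Y * ul Y z)" using assms by (auto simp: zspan_def)
  have ac: "a w = c Y" if "Y \<in> S" "w \<in> Y" for Y w
    unfolding c using sum_ul_at[OF that, of c] by simp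
  have "\<pi> a = (\<Sum>Y\<in>S. of_int (c Y) * (\<Sum>w\<in>Y. sph w))"
    unfolding c pi_combination by (simp add: pi_ul)
  also have "\<dots> = (\<Sum>Y\<in>S. \<Sum>w\<in>Y. of_int (a w) * sph w)"
    by (simp add: ac sum_distrib_left)
  finally show ?thesis by (simp add: sum_carrier_blocks)
qed

text \<open>The left side, as a function of \<open>w\<close>, is a combination of the products of
  \<open>star a\<close> with basic sets, hence constant on the basic set \<open>Z\<close> of
  \<open>w\<close>. Summed over \<open>Z\<close> it becomes the value of \<open>\<pi>\<close> at the
  product of \<open>a\<close> and \<open>ul Z\<close>, where multiplicativity applies.\<close>

lemma sph_translate:
  assumes a: "a \<in> zspan S" and w: "w \<in> carrier G"
  shows "(\<Sum>x\<in>carrier G. of_int (a x) * sph (x \<otimes> w)) = \<pi> a * sph w"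
proof -
  define g where "g w = (\<Sum>x\<in>carrier G. of_int (a x) * sph (x \<otimes> w))" for w
  obtain Z where Z: "Z \<in> S" "w \<in> Z" using block_exists w by auto
  have g: "g u = (\<Sum>Y\<in>S. \<pi> (ul Y) / of_nat (card Y) * of_int (gr_mult G (star a) (ul Y) u))"
    if "u \<in> carrier G" for u
  proof -
    have "g u = (\<Sum>x\<in>carrier G. \<Sum>Y\<in>S. \<pi> (ul Y) / of_nat (card Y) * of_int (a x * ul Y (x \<otimes> u)))"
      by (simp add: g_def sph_def sum_distrib_left mult_ac)
    also have "\<dots> = (\<Sum>Y\<in>S. \<Sum>x\<in>carrier G. \<pi> (ul Y) / of_nat (card Y) * of_int (a x * ul Y (x \<otimes> u)))"
      by (rule sum.swap)
    finally show ?thesis by (simp add: gr_mult_star[OF that] sum_distrib_left)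
  qed
  have gconst: "g u = g w" if "u \<in> Z" for u
  proof -
    have "gr_mult G (star a) (ul Y) u = gr_mult G (star a) (ul Y) w" if "Y \<in> S" for Y
      using zspan_const[OF mult_zspan[OF star_zspan[OF a] ul_zspan[OF that]] Z(1) \<open>u \<in> Z\<close> Z(2)] .
    moreover have "u \<in> carrier G" using that Z block_subset by auto
    ultimately show ?thesis using w by (simp add: g)
  qed
  have "of_nat (card Z) * g w = (\<Sum>u\<in>Z. g u)" using gconst by simp
  also have "\<dots> = (\<Sum>u\<in>carrier G. of_int (ul Z u) * g u)" using Z by (simp add: sum_ul_block)
  also have "\<dots> = (\<Sum>u\<in>carrier G. \<Sum>x\<in>carrier G. of_int (a x) * (of_int (ul Z u) * sph (x \<otimes> u)))"
    by (simp add: g_def sum_distrib_left mult_ac)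
  also have "\<dots> = (\<Sum>x\<in>carrier G. \<Sum>u\<in>carrier G. of_int (a x) * (of_int (ul Z u) * sph (x \<otimes> u)))"
    by (rule sum.swap)
  also have "\<dots> = (\<Sum>x\<in>carrier G. \<Sum>u\<in>carrier G. of_int (a x) * (of_int (ul Z (inv x \<otimes> u)) * sph u))"
  proof (rule sum.cong[OF refl])
    fix x assume x: "x \<in> carrier G"
    show "(\<Sum>u\<in>carrier G. of_int (a x) * (of_int (ul Z u) * sph (x \<otimes> u))) =
      (\<Sum>u\<in>carrier G. of_int (a x) * (of_int (ul Z (inv x \<otimes> u)) * sph u))"
      using x by (subst sum_carrier_mult_left[of "inv x", symmetric]) (auto simp: m_assoc[symmetric] intro!: sum.cong)
  qed
  also have "\<dots> = (\<Sum>u\<in>carrier G. \<Sum>x\<in>carrier G. of_int (a x) * (of_int (ul Z (inv x \<otimes> u)) * sph u))"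
    by (rule sum.swap)
  also have "\<dots> = (\<Sum>u\<in>carrier G. of_int (gr_mult G a (ul Z) u) * sph u)"
    by (simp add: gr_mult_def sum_distrib_right sum_distrib_left mult_ac)
  also have "\<dots> = \<pi> a * \<pi> (ul Z)"
    using a Z by (simp add: mult_zspan ul_zspan pi_mult flip: pi_eq_sum)
  also have "\<pi> (ul Z) = of_nat (card Z) * sph w"
    using sph_block[OF Z] card_block_pos[OF Z(1)] by simp
  finally show ?thesis
    using card_block_pos[OF Z(1)] by (simp add: g_def)
qed

lemma sph_commute: "x \<in> carrier G \<Longrightarrow> y \<in> carrier G \<Longrightarrow> sph (x \<otimes> y) = sph (y \<otimes> x)"
  unfolding sph_def using central_conj[OF ul_zspan] by simp

text \<open>Translation at the identity gives \<open>\<pi> a = \<pi> a * sph \<one>\<close>; a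
  nonzero value of \<open>\<pi>\<close> can be cancelled.\<close>

lemma sph_one: "sph \<one> = 1"
proof -
  have one: "{\<one>} \<in> S" using sring by (simp add: S_ring_def)
  obtain a where a: "a \<in> zspan S" "\<pi> a \<noteq> 0" using pi_nonzero by auto
  have "\<pi> a = \<pi> a * sph \<one>" using sph_translate[OF a(1), of \<one>] by (simp add: pi_eq_sum[OF a(1)])
  then show ?thesis using a by simp
qed

text \<open>This is the factor tau, introduced as a squared norm so that it is visibly nonzero once
  \<open>sph \<one> = 1\<close> is known.\<close>

definition sph_norm :: complex where
  "sph_norm = (\<Sum>x\<in>carrier G. sph x * cnj (sph x))"

lemma sph_norm_nonzero: "sph_norm \<noteq> 0"
proof -
  have N: "sph_norm = of_real (\<Sum>w\<in>carrier G. (cmod (sph w))\<^sup>2)"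
    by (simp add: sph_norm_def complex_norm_square[symmetric])
  have "0 < (\<Sum>w\<in>carrier G. (cmod (sph w))\<^sup>2)"
    using sph_one by (intro sum_pos2[OF fin, of \<one>]) auto
  then show ?thesis unfolding N by (simp only: of_real_eq_0_iff)
qed

text \<open>Translations are unitary, so the eigenvalue of the adjoint is the conjugate eigenvalue.\<close>

lemma pi_star:
  assumes a: "a \<in> zspan S"
  shows "\<pi> (star a) = cnj (\<pi> a)"
proof -
  have "\<pi> a * sph_norm = (\<Sum>w\<in>carrier G. (\<Sum>x\<in>carrier G. of_int (a x) * sph (x \<otimes> w)) * cnj (sph w))"
    by (simp add: sph_norm_def sph_translate[OF a] sum_distrib_left mult_ac)
  also have "\<dots> = (\<Sum>w\<in>carrier G. \<Sum>x\<in>carrier G. of_int (a x) * sph (x \<otimes> w) * cnj (sph w))"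
    by (simp add: sum_distrib_right)
  also have "\<dots> = (\<Sum>x\<in>carrier G. \<Sum>w\<in>carrier G. of_int (a x) * sph (x \<otimes> w) * cnj (sph w))"
    by (rule sum.swap)
  also have "\<dots> = (\<Sum>x\<in>carrier G. \<Sum>w\<in>carrier G. of_int (a x) * sph w * cnj (sph (inv x \<otimes> w)))"
  proof (rule sum.cong[OF refl])
    fix x assume x: "x \<in> carrier G"
    show "(\<Sum>w\<in>carrier G. of_int (a x) * sph (x \<otimes> w) * cnj (sph w)) =
      (\<Sum>w\<in>carrier G. of_int (a x) * sph w * cnj (sph (inv x \<otimes> w)))"
      using x by (subst sum_carrier_mult_left[of "inv x", symmetric]) (auto simp: m_assoc[symmetric] intro!: sum.cong)
  qed
  also have "\<dots> = (\<Sum>x\<in>carrier G. \<Sum>w\<in>carrier G. of_int (star a x) * sph w * cnj (sph (x \<otimes> w)))"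
    by (subst sum_carrier_inv[symmetric]) (simp add: star_def)
  also have "\<dots> = (\<Sum>w\<in>carrier G. \<Sum>x\<in>carrier G. of_int (star a x) * sph w * cnj (sph (x \<otimes> w)))"
    by (rule sum.swap)
  also have "\<dots> = (\<Sum>w\<in>carrier G. sph w * cnj (\<Sum>x\<in>carrier G. of_int (star a x) * sph (x \<otimes> w)))"
    by (simp add: sum_distrib_left mult_ac)
  also have "\<dots> = cnj (\<pi> (star a)) * sph_norm"
    by (simp add: sph_translate[OF star_zspan[OF a]] sph_norm_def sum_distrib_left mult_ac)
  finally have "\<pi> a = cnj (\<pi> (star a))" using sph_norm_nonzero by simp
  then show ?thesis by simp
qed

lemma star_ul: "Y \<in> S \<Longrightarrow> star (ul Y) = ul ((\<lambda>x. inv x) ` Y)"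
  using block_subset by (force simp: star_def ul_def image_iff)

lemma sph_inv:
  assumes "w \<in> carrier G"
  shows "sph (inv w) = cnj (sph w)"
proof -
  obtain Y where Y: "Y \<in> S" "w \<in> Y" using block_exists assms by auto
  have "card ((\<lambda>x. inv x) ` Y) = card Y"
    using block_subset[OF Y(1)] by (intro card_image inj_onI) (metis inv_inv subsetD)
  then have "sph (inv w) = \<pi> (star (ul Y)) / of_nat (card Y)"
    using sph_block[OF inv_block[OF Y(1)]] Y by (simp add: star_ul)
  then show ?thesis using Y by (simp add: pi_star[OF ul_zspan] sph_block)
qed

text \<open>Expand the first factor into basic sets. Each of them acts on \<open>sph\<close> by a
  scalar, with \<open>star\<close> accounting for the inverse in the second factor. Evaluation at
  the identity, where \<open>sph\<close> is 1, identifies the total scalar.\<close>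

lemma sph_convolution:
  assumes w: "w \<in> carrier G"
  shows "(\<Sum>x\<in>carrier G. sph x * sph (inv x \<otimes> w)) = sph_norm * sph w"
proof -
  define \<tau> where "\<tau> = (\<Sum>Y\<in>S. \<pi> (ul Y) / of_nat (card Y) * \<pi> (star (ul Y)))"
  have conv: "(\<Sum>x\<in>carrier G. sph x * sph (inv x \<otimes> w)) = \<tau> * sph w" if w: "w \<in> carrier G" for w
  proof -
    have "(\<Sum>x\<in>carrier G. sph x * sph (inv x \<otimes> w)) =
        (\<Sum>x\<in>carrier G. \<Sum>Y\<in>S. \<pi> (ul Y) / of_nat (card Y) * (of_int (ul Y x) * sph (inv x \<otimes> w)))"
      unfolding sph_def[of x for x] sum_distrib_right by (simp add: sph_def mult_ac)
    also have "\<dots> = (\<Sum>Y\<in>S. \<Sum>x\<in>carrier G. \<pi> (ul Y) / of_nat (card Y) * (of_int (ul Y x) * sph (inv x \<otimes> w)))"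
      by (rule sum.swap)
    also have "\<dots> = (\<Sum>Y\<in>S. \<pi> (ul Y) / of_nat (card Y) * (\<Sum>x\<in>carrier G. of_int (ul Y x) * sph (inv x \<otimes> w)))"
      by (simp add: sum_distrib_left)
    also have "\<dots> = (\<Sum>Y\<in>S. \<pi> (ul Y) / of_nat (card Y) * (\<Sum>x\<in>carrier G. of_int (star (ul Y) x) * sph (x \<otimes> w)))"
      by (subst (2) sum_carrier_inv[symmetric]) (simp add: star_def)
    also have "\<dots> = \<tau> * sph w"
      by (simp add: \<tau>_def sph_translate[OF star_zspan[OF ul_zspan] w] sum_distrib_right sum_distrib_left mult_ac)
    finally show ?thesis .
  qed
  have "\<tau> = (\<Sum>x\<in>carrier G. sph x * sph (inv x))" using conv[of \<one>] by (simp add: sph_one)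
  then have "\<tau> = sph_norm" by (simp add: sph_inv sph_norm_def)
  then show ?thesis using conv[OF w] by simp
qed

end

section \<open>Powers in finite groups\<close>

context group
begin

lemma pow_cong_ord:
  assumes x: "x \<in> carrier G" and ab: "[a = b] (mod ord x)"
  shows "x [^] a = x [^] b"
proof -
  have red: "x [^] k = x [^] (k mod ord x)" for k
  proof -
    have "x [^] k = x [^] (ord x * (k div ord x) + k mod ord x)" by simp
    also have "\<dots> = (x [^] ord x) [^] (k div ord x) \<otimes> x [^] (k mod ord x)"
      by (simp only: nat_pow_mult[OF x] nat_pow_pow[OF x])
    also have "\<dots> = x [^] (k mod ord x)" using x by simp
    finally show ?thesis .
  qed
  show ?thesis using ab by (subst (1 2) red) (simp add: cong_def)
qed

lemma pow_coprime_bij: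
  assumes fin: "finite (carrier G)" and m: "coprime m (order G)"
  shows "bij_betw (\<lambda>x. x [^] (m :: nat)) (carrier G) (carrier G)"
proof -
  obtain k where k: "[m * k = 1] (mod order G)"
    using cong_solve_coprime_nat[OF m] by auto
  have "(x [^] m) [^] k = x" if x: "x \<in> carrier G" for x
  proof -
    have "[m * k = 1] (mod ord x)" using k ord_dvd_group_order[OF x] by (rule cong_dvd_modulus_nat)
    then show ?thesis using pow_cong_ord[OF x, of "m * k" 1] x by (simp add: nat_pow_pow)
  qed
  then have "inj_on (\<lambda>x. x [^] m) (carrier G)" by (rule inj_on_inverseI)
  moreover have "(\<lambda>x. x [^] m) ` carrier G \<subseteq> carrier G" by auto
  ultimately show ?thesis using endo_inj_surj[OF fin] by (auto simp: bij_betw_def)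
qed

text \<open>Equality of orders makes the exponent coprime to \<open>ord y\<close> only, whereas
  invariance of \<open>sph\<close> concerns exponents coprime to the order of the whole group. The
  exponent may be changed modulo \<open>ord y\<close>.\<close>

lemma same_order_in_cyclic:
  assumes fin: "finite (carrier G)" and y: "y \<in> carrier G"
    and h: "h \<in> generate G {y}" and ord: "ord h = ord y"
  obtains m where "coprime m (order G)" "h = y [^] (m :: nat)"
proof -
  have n: "order G > 0" by (simp add: fin order_gt_0_iff_finite)
  have o: "ord y \<ge> 1" using ord_ge_1[OF fin y] .
  obtain k :: nat where k: "h = y [^] k" using h generate_pow_on_finite_carrier[OF fin y] by auto
  have "coprime k (ord y)"
  proof (cases "k = 0")
    case True
    then show ?thesis using ord ord_pow_gen[OF y, of k] k by simp
  next
    case False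
    then have "ord y div gcd (ord y) k = ord y" using ord ord_pow_gen[OF y, of k] k by simp
    then have "gcd (ord y) k = 1" using o by (metis div_eq_dividend_iff less_eq_Suc_le One_nat_def)
    then show ?thesis by (metis coprime_iff_gcd_eq_1 gcd.commute)
  qed
  \<comment> \<open>With the bound \<open>order G\<close>, no prime factor of \<open>m\<close> is
    small enough to divide the group order.\<close>
  then obtain m where m: "[m = k] (mod ord y)" "\<And>p. prime p \<Longrightarrow> p dvd m \<Longrightarrow> p > order G"
    using coprime_lift_large_primes[of "ord y" k "order G"] o by auto
  have "coprime m (order G)"
  proof (rule ccontr)
    assume "\<not> coprime m (order G)"
    then have "gcd m (order G) \<noteq> 1" by (metis coprime_iff_gcd_eq_1)
    then obtain p where "prime p" "p dvd gcd m (order G)" using prime_factor_nat by blast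
    then have p: "prime p" "p dvd m" "p dvd order G" by auto
    then show False using m(2)[OF p(1,2)] dvd_imp_le[OF p(3) n] by simp
  qed
  moreover have "h = y [^] m" using pow_cong_ord[OF y m(1)] k by simp
  ultimately show ?thesis by (rule that)
qed

text \<open>Convolution with \<open>w\<close> has the matrix with entries
  \<open>w (inv x \<otimes> y)\<close>. It is idempotent and each of its diagonal entries equals
  \<open>w \<one>\<close>.\<close>

lemma convolution_idempotent_trace:
  fixes w :: "'a \<Rightarrow> 'c :: field"
  assumes fin: "finite (carrier G)"
    and idem: "\<And>g. g \<in> carrier G \<Longrightarrow> (\<Sum>x\<in>carrier G. w x * w (inv x \<otimes> g)) = w g"
  shows "of_nat (order G) * w \<one> \<in> \<nat>"
proof -
  have "(\<Sum>x\<in>carrier G. w (inv x \<otimes> x)) \<in> \<nat>"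
  proof (rule trace_idempotent_Nats[OF fin, of "\<lambda>x y. w (inv x \<otimes> y)"])
    fix x y assume x: "x \<in> carrier G" and y: "y \<in> carrier G"
    have "(\<Sum>z\<in>carrier G. w (inv x \<otimes> z) * w (inv z \<otimes> y)) =
        (\<Sum>z\<in>carrier G. w z * w (inv z \<otimes> (inv x \<otimes> y)))"
      using x y by (subst sum_carrier_mult_left[of x, symmetric])
        (auto simp: m_assoc[symmetric] inv_mult_group intro!: sum.cong)
    then show "(\<Sum>z\<in>carrier G. w (inv x \<otimes> z) * w (inv z \<otimes> y)) = w (inv x \<otimes> y)"
      using idem x y by simp
  qed
  then show ?thesis by (simp add: Coset.order_def)
qed

end

section \<open>Rational S-rings have rational characters\<close>

context S_ring_character
begin

lemma subgroup_sum_rational: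
  assumes H: "subgroup H G"
  shows "(\<Sum>h\<in>H. sph h) / sph_norm \<in> \<rat>"
proof -
  interpret H: subgroup H G by (rule H)
  have finH: "finite H" using finite_subset[OF H.subset fin] .
  have "\<one> \<in> H" by simp
  then have cH: "card H > 0" using finH card_gt_0_iff by blast
  \<comment> \<open>The convolution of \<open>sph / sph_norm\<close> with the uniform distribution
    on \<open>H\<close>. Its value at the identity is the sum of \<open>sph\<close> over
    \<open>H\<close>, up to known factors.\<close>
  define w where "w g = (\<Sum>h\<in>H. sph (g \<otimes> h)) / (sph_norm * of_nat (card H))" for g
  \<comment> \<open>Substituting \<open>x \<otimes> inv h\<close> for \<open>x\<close> moves
    \<open>h\<close> to the front of the second argument; since \<open>sph\<close> is a class
    function, it can be carried around to the end.\<close>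
  have one: "(\<Sum>x\<in>carrier G. sph (x \<otimes> h) * sph (inv x \<otimes> g \<otimes> h')) = sph_norm * sph (g \<otimes> (h' \<otimes> h))"
    if h: "h \<in> H" and h': "h' \<in> H" and g: "g \<in> carrier G" for h h' g
  proof -
    have "(\<Sum>x\<in>carrier G. sph (x \<otimes> h) * sph (inv x \<otimes> g \<otimes> h')) =
        (\<Sum>x\<in>carrier G. sph x * sph (inv x \<otimes> (g \<otimes> (h' \<otimes> h))))"
    proof (subst sum_carrier_mult_right[of "inv h", symmetric])
      show "(\<Sum>x\<in>carrier G. sph (x \<otimes> inv h \<otimes> h) * sph (inv (x \<otimes> inv h) \<otimes> g \<otimes> h')) =
        (\<Sum>x\<in>carrier G. sph x * sph (inv x \<otimes> (g \<otimes> (h' \<otimes> h))))"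
      proof (rule sum.cong[OF refl])
        fix x assume x: "x \<in> carrier G"
        have "sph (inv (x \<otimes> inv h) \<otimes> g \<otimes> h') = sph (h \<otimes> (inv x \<otimes> g \<otimes> h'))"
          using x h h' g by (simp add: inv_mult_group m_assoc)
        also have "\<dots> = sph (inv x \<otimes> g \<otimes> h' \<otimes> h)" using x h h' g by (simp add: sph_commute)
        finally show "sph (x \<otimes> inv h \<otimes> h) * sph (inv (x \<otimes> inv h) \<otimes> g \<otimes> h') =
            sph x * sph (inv x \<otimes> (g \<otimes> (h' \<otimes> h)))"
          using x h h' g by (simp add: m_assoc)
      qed
    qed (use h in simp)
    then show ?thesis using g h h' by (simp add: sph_convolution)
  qed
  have idem: "(\<Sum>x\<in>carrier G. w x * w (inv x \<otimes> g)) = w g" if g: "g \<in> carrier G" for g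
  proof -
    \<comment> \<open>Right multiplication by \<open>h\<close> permutes \<open>H\<close>, so the
      inner sum is independent of \<open>h\<close> and the outer sum just contributes the factor
      \<open>card H\<close>.\<close>
    have shift: "(\<Sum>h'\<in>H. sph (g \<otimes> (h' \<otimes> h))) = (\<Sum>h'\<in>H. sph (g \<otimes> h'))" if h: "h \<in> H" for h
      by (rule sum.reindex_bij_witness[of _ "\<lambda>x. x \<otimes> inv h" "\<lambda>x. x \<otimes> h"]) (use h in \<open>auto simp: m_assoc\<close>)
    define c where "c = sph_norm * of_nat (card H)"
    have "(\<Sum>x\<in>carrier G. w x * w (inv x \<otimes> g)) =
        (\<Sum>x\<in>carrier G. \<Sum>h\<in>H. \<Sum>h'\<in>H. sph (x \<otimes> h) * sph (inv x \<otimes> g \<otimes> h')) / c\<^sup>2"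
      by (simp add: w_def c_def[symmetric] power2_eq_square sum_product sum_divide_distrib)
    also have "(\<Sum>x\<in>carrier G. \<Sum>h\<in>H. \<Sum>h'\<in>H. sph (x \<otimes> h) * sph (inv x \<otimes> g \<otimes> h')) =
        (\<Sum>h\<in>H. \<Sum>x\<in>carrier G. \<Sum>h'\<in>H. sph (x \<otimes> h) * sph (inv x \<otimes> g \<otimes> h'))"
      by (rule sum.swap)
    also have "\<dots> = (\<Sum>h\<in>H. \<Sum>h'\<in>H. \<Sum>x\<in>carrier G. sph (x \<otimes> h) * sph (inv x \<otimes> g \<otimes> h'))"
      by (rule sum.cong[OF refl], rule sum.swap)
    also have "\<dots> = (\<Sum>h\<in>H. sph_norm * (\<Sum>h'\<in>H. sph (g \<otimes> (h' \<otimes> h))))"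
      using g by (simp add: one sum_distrib_left)
    also have "\<dots> = c * (\<Sum>h'\<in>H. sph (g \<otimes> h'))" by (simp add: shift c_def)
    also have "\<dots> / c\<^sup>2 = w g" by (simp add: w_def c_def power2_eq_square)
    finally show ?thesis .
  qed
  have "of_nat (order G) * w \<one> \<in> \<nat>" using fin idem by (rule convolution_idempotent_trace)
  then have "of_nat (order G) * w \<one> \<in> \<rat>" using Nats_subset_Rats by blast
  then have "of_nat (card H) * (of_nat (order G) * w \<one>) / of_nat (order G) \<in> \<rat>"
    by (rule Rats_divide[OF Rats_mult[OF Rats_of_nat] Rats_of_nat])
  moreover have "of_nat (card H) * (of_nat (order G) * w \<one>) / of_nat (order G) = (\<Sum>h\<in>H. sph h) / sph_norm"
  proof -
    have "order G > 0" by (simp add: fin order_gt_0_iff_finite)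
    moreover have "(\<Sum>h\<in>H. sph (\<one> \<otimes> h)) = (\<Sum>h\<in>H. sph h)" by (rule sum.cong) auto
    ultimately show ?thesis using cH sph_norm_nonzero by (simp add: w_def field_simps)
  qed
  ultimately show ?thesis by simp
qed

lemma sph_rational:
  assumes inv: "\<And>x m. x \<in> carrier G \<Longrightarrow> coprime m (order G) \<Longrightarrow> sph (x [^] (m :: nat)) = sph x"
  shows "y \<in> carrier G \<Longrightarrow> sph y \<in> \<rat>"
proof (induction "ord y" arbitrary: y rule: less_induct)
  case less
  \<comment> \<open>For the trivial subgroup the rational quotient is \<open>1 / sph_norm\<close>.
    From now on \<open>sph_norm\<close> can be cleared from the sums over larger subgroups.\<close>
  have "sph_norm \<in> \<rat>"
  proof -
    have "1 / sph_norm \<in> \<rat>" using subgroup_sum_rational[OF triv_subgroup] by (simp add: sph_one)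
    then have "1 / (1 / sph_norm) \<in> \<rat>" by (rule Rats_divide[OF Rats_1])
    then show ?thesis by simp
  qed
  define H where "H = generate G {y}"
  have H: "subgroup H G" unfolding H_def using less.prems by (intro generate_is_subgroup) auto
  then have HG: "H \<subseteq> carrier G" by (rule subgroup.subset)
  then have finH: "finite H" using fin finite_subset by auto
  have yH: "y \<in> H" unfolding H_def by (rule generate.incl) simp
  have "(\<Sum>h\<in>H. sph h) / sph_norm * sph_norm \<in> \<rat>"
    using subgroup_sum_rational[OF H] \<open>sph_norm \<in> \<rat>\<close> by (rule Rats_mult)
  then have total: "(\<Sum>h\<in>H. sph h) \<in> \<rat>" using sph_norm_nonzero by simp
  \<comment> \<open>The generators of \<open>H\<close>. Each is a power of \<open>y\<close> with
    exponent coprime to the group order, so all share the value \<open>sph y\<close>; the rest of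
    \<open>H\<close> has smaller order and falls under the induction hypothesis.\<close>
  define K where "K = {h \<in> H. ord h = ord y}"
  have "sph h = sph y" if "h \<in> K" for h
    using that same_order_in_cyclic[OF fin less.prems, of h] inv less.prems unfolding K_def H_def
    by (metis (mono_tags, lifting) mem_Collect_eq)
  then have sK: "(\<Sum>h\<in>K. sph h) = of_nat (card K) * sph y" by simp
  have "(\<Sum>h\<in>H - K. sph h) \<in> \<rat>"
  proof (rule sum_rational)
    fix h assume h: "h \<in> H - K"
    then obtain k :: nat where k: "h = y [^] k"
      using generate_pow_on_finite_carrier[OF fin less.prems] by (auto simp: H_def)
    have o: "ord y \<ge> 1" using ord_ge_1[OF fin less.prems] .
    have "ord h \<le> ord y" using ord_pow_gen[OF less.prems, of k] k o by auto
    then have "ord h < ord y" using h by (auto simp: K_def)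
    then show "sph h \<in> \<rat>" using less.hyps h HG by auto
  qed
  then have "(\<Sum>h\<in>H. sph h) - (\<Sum>h\<in>H - K. sph h) \<in> \<rat>" using total by (rule Rats_diff[rotated])
  moreover have "(\<Sum>h\<in>H. sph h) = (\<Sum>h\<in>H - K. sph h) + (\<Sum>h\<in>K. sph h)"
    by (rule sum.subset_diff) (auto simp: K_def finH)
  ultimately have "of_nat (card K) * sph y / of_nat (card K) \<in> \<rat>"
    using sK by (intro Rats_divide) auto
  moreover have "card K > 0" using yH finH by (auto simp: K_def card_gt_0_iff)
  ultimately show ?case by simp
qed

end

section \<open>Rational characters are invariant under powers\<close>

context group
begin

definition list_mult :: "'a list \<Rightarrow> 'a" where
  "list_mult xs = foldr (\<otimes>) xs \<one>"

lemma list_mult_closed: "set xs \<subseteq> carrier G \<Longrightarrow> list_mult xs \<in> carrier G"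
  by (induction xs) (auto simp: list_mult_def)

lemma list_mult_append:
  "set xs \<subseteq> carrier G \<Longrightarrow> set ys \<subseteq> carrier G \<Longrightarrow> list_mult (xs @ ys) = list_mult xs \<otimes> list_mult ys"
  using list_mult_closed by (induction xs) (auto simp: list_mult_def m_assoc)

lemma list_mult_replicate: "x \<in> carrier G \<Longrightarrow> list_mult (replicate k x) = x [^] k"
  by (induction k) (simp_all only: replicate.simps list_mult_def foldr.simps o_apply id_apply nat_pow_0 nat_pow_Suc2)

text \<open>Only the constant words survive modulo p when the words of length p over U are rotated.\<close>

lemma sum_words_cong:
  fixes \<theta> :: "'a \<Rightarrow> int"
  assumes fin: "finite U" and U: "U \<subseteq> carrier G" and p: "prime p"
    and comm: "\<And>x y. x \<in> carrier G \<Longrightarrow> y \<in> carrier G \<Longrightarrow> \<theta> (x \<otimes> y) = \<theta> (y \<otimes> x)"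
  shows "[(\<Sum>xs | set xs \<subseteq> U \<and> length xs = p. \<theta> (list_mult xs)) = (\<Sum>x\<in>U. \<theta> (x [^] p))] (mod int p)"
proof -
  define A where "A = {xs. set xs \<subseteq> U \<and> length xs = p}"
  have p0: "p > 0" using p by (simp add: prime_gt_0_nat)
  have rot: "\<theta> (list_mult (rotate1 xs)) = \<theta> (list_mult xs)" if "xs \<in> A" for xs
  proof (cases xs)
    case (Cons x ys)
    then have "x \<in> carrier G" "set ys \<subseteq> carrier G" using that U by (auto simp: A_def)
    then show ?thesis using comm[of x "list_mult ys"] Cons
      by (simp add: list_mult_append list_mult_closed) (simp add: list_mult_def)
  qed simp
  have "[(\<Sum>xs\<in>A. \<theta> (list_mult xs)) = (\<Sum>xs | xs \<in> A \<and> rotate1 xs = xs. \<theta> (list_mult xs))] (mod int p)"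
  proof (rule sum_cong_fixed_points[OF p])
    show "finite A" unfolding A_def using fin by (rule finite_lists_length_eq)
    show "(rotate1 ^^ p) xs = xs" if "xs \<in> A" for xs
      using that rotate_id[of p xs] by (simp add: A_def rotate_def)
  qed (use rot in \<open>auto simp: A_def\<close>)
  also have "{xs. xs \<in> A \<and> rotate1 xs = xs} = replicate p ` U"
  proof (intro equalityI subsetI)
    fix xs assume xs: "xs \<in> {xs. xs \<in> A \<and> rotate1 xs = xs}"
    then have "card (set xs) = 1" using rotate1_fixpoint_card[of xs] p0 by (auto simp: A_def)
    then obtain x where "set xs = {x}" by (auto simp: card_1_singleton_iff)
    then have "xs = replicate p x" "x \<in> U" using xs by (auto simp: A_def intro: replicate_eqI)
    then show "xs \<in> replicate p ` U" by auto
  qed (use p0 in \<open>auto simp: A_def\<close>)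
  also have "(\<Sum>xs\<in>replicate p ` U. \<theta> (list_mult xs)) = (\<Sum>x\<in>U. \<theta> (x [^] p))"
  proof -
    have "inj_on (replicate p) U" using p0 by (auto simp: inj_on_def)
    moreover have "list_mult (replicate p x) = x [^] p" if "x \<in> U" for x
      using that U by (auto simp: list_mult_replicate)
    ultimately show ?thesis by (simp add: sum.reindex)
  qed
  finally show ?thesis by (simp add: A_def)
qed

end

context S_ring_character
begin

text \<open>Each letter prefixed to a word contributes one factor \<open>\<pi> (ul U)\<close> by
  \<open>sph_translate\<close>, starting from \<open>sph \<one> = 1\<close>. All lengths are needed:
  length \<open>p\<close> for the congruence, and arbitrary lengths for integrality.\<close>

lemma pi_power:
  assumes U: "U \<in> S"
  shows "(\<Sum>xs | set xs \<subseteq> U \<and> length xs = k. sph (list_mult xs)) = \<pi> (ul U) ^ k"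
proof (induction k)
  case 0
  have "{xs. set xs \<subseteq> U \<and> length xs = 0} = {[]}" by auto
  then show ?case by (simp add: list_mult_def sph_one)
next
  case (Suc k)
  define L where "L = {xs. set xs \<subseteq> U \<and> length xs = k}"
  have "{xs. set xs \<subseteq> U \<and> length xs = Suc k} = (\<lambda>(x, xs). x # xs) ` (U \<times> L)"
    unfolding L_def lists_length_Suc_eq by auto
  then have "(\<Sum>xs | set xs \<subseteq> U \<and> length xs = Suc k. sph (list_mult xs)) =
      (\<Sum>(x, xs)\<in>U \<times> L. sph (x \<otimes> list_mult xs))"
    by (simp add: sum.reindex inj_on_def case_prod_unfold list_mult_def)
  also have "\<dots> = (\<Sum>x\<in>U. \<Sum>xs\<in>L. sph (x \<otimes> list_mult xs))"
    by (rule sum.cartesian_product[symmetric])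
  also have "\<dots> = (\<Sum>xs\<in>L. \<Sum>x\<in>U. sph (x \<otimes> list_mult xs))"
    by (rule sum.swap)
  also have "\<dots> = (\<Sum>xs\<in>L. \<pi> (ul U) * sph (list_mult xs))"
  proof (rule sum.cong[OF refl])
    fix xs assume "xs \<in> L"
    then have "list_mult xs \<in> carrier G"
      using block_subset[OF U] by (intro list_mult_closed) (auto simp: L_def)
    then show "(\<Sum>x\<in>U. sph (x \<otimes> list_mult xs)) = \<pi> (ul U) * sph (list_mult xs)"
      using sph_translate[OF ul_zspan[OF U]] by (simp add: sum_ul_block[OF U])
  qed
  finally show ?case using Suc by (simp add: L_def flip: sum_distrib_left)
qed

lemma sph_large_prime_power:
  assumes rat: "\<And>w. w \<in> carrier G \<Longrightarrow> sph w \<in> \<rat>"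
  obtains B where "\<And>p x. prime p \<Longrightarrow> p > B \<Longrightarrow> x \<in> carrier G \<Longrightarrow> sph (x [^] (p :: nat)) = sph x"
proof -
  obtain D :: int where D: "D > 0" "\<And>w. w \<in> carrier G \<Longrightarrow> of_int D * sph w \<in> \<int>"
    using common_denominator[OF fin, of sph] rat by blast
  have "\<forall>w\<in>carrier G. \<exists>t. of_int D * sph w = of_int t"
    using D(2) by (meson Ints_cases)
  then obtain \<theta> :: "'a \<Rightarrow> int" where \<theta>: "\<And>w. w \<in> carrier G \<Longrightarrow> of_int D * sph w = of_int (\<theta> w)"
    by metis
  have \<theta>_eq: "\<theta> x = \<theta> y \<longleftrightarrow> sph x = sph y" if "x \<in> carrier G" "y \<in> carrier G" for x y
  proof -
    have "\<theta> x = \<theta> y \<longleftrightarrow> of_int D * sph x = of_int D * sph y" using \<theta> that by simp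
    then show ?thesis using D(1) by simp
  qed
  have comm: "\<theta> (x \<otimes> y) = \<theta> (y \<otimes> x)" if "x \<in> carrier G" "y \<in> carrier G" for x y
    using that by (simp add: \<theta>_eq sph_commute)
  define M where "M = (\<Sum>x\<in>carrier G. \<bar>\<theta> x\<bar>)"
  have M: "\<bar>\<theta> x\<bar> \<le> M" if "x \<in> carrier G" for x
    unfolding M_def using fin that by (intro member_le_sum) auto
  have M0: "M \<ge> 0" unfolding M_def by (intro sum_nonneg) simp
  \<comment> \<open>The first summand makes \<open>p\<close> prime to the group order, so that the
    \<open>p\<close>-th power map is a bijection. The second exceeds any difference of two sums of
    values of \<open>\<theta>\<close> over a basic set, so that congruence modulo \<open>p\<close>
    means equality.\<close>
  define B where "B = order G + nat (2 * int (order G) * M)"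
  have "sph (y [^] p) = sph y" if p: "prime p" "p > B" and y: "y \<in> carrier G" for p y
  proof -
    have block: "(\<Sum>x\<in>U. \<theta> (x [^] p)) = (\<Sum>x\<in>U. \<theta> x)" if U: "U \<in> S" for U
    proof -
      have UG: "x \<in> carrier G" if "x \<in> U" for x using that block_subset[OF U] by auto
      have words: "of_int D * \<pi> (ul U) ^ k = of_int (\<Sum>xs | set xs \<subseteq> U \<and> length xs = k. \<theta> (list_mult xs))" for k
      proof -
        have "of_int D * sph (list_mult xs) = of_int (\<theta> (list_mult xs))" if "set xs \<subseteq> U" for xs
          using that block_subset[OF U] by (intro \<theta> list_mult_closed) auto
        then show ?thesis by (simp add: sum_distrib_left flip: pi_power[OF U])
      qed
      \<comment> \<open>By \<open>words\<close>, the same \<open>D\<close> clears every power of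
        this rational number.\<close>
      have "\<pi> (ul U) \<in> \<int>"
      proof (rule rational_power_bounded_denominator)
        show "\<pi> (ul U) \<in> \<rat>" unfolding pi_ul[OF U, symmetric] using rat UG by (intro sum_rational) auto
        show "of_int D * \<pi> (ul U) ^ k \<in> \<int>" for k unfolding words by (rule Ints_of_int)
      qed (use D in simp)
      then obtain z where z: "\<pi> (ul U) = of_int z" by (elim Ints_cases)
      have wz: "D * z ^ k = (\<Sum>xs | set xs \<subseteq> U \<and> length xs = k. \<theta> (list_mult xs))" for k
        using words[of k] unfolding z by (metis of_int_eq_iff of_int_mult of_int_power)
      have Dz: "D * z = (\<Sum>x\<in>U. \<theta> x)"
      proof -
        have "of_int (D * z) = of_int D * \<pi> (ul U)" by (simp add: z)
        also have "\<dots> = (\<Sum>x\<in>U. of_int D * sph x)" by (simp add: sum_distrib_left flip: pi_ul[OF U])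
        also have "\<dots> = of_int (\<Sum>x\<in>U. \<theta> x)" by (simp add: \<theta> UG)
        finally show ?thesis by (simp only: of_int_eq_iff)
      qed
      have "[D * z ^ p = (\<Sum>x\<in>U. \<theta> (x [^] p))] (mod int p)"
        unfolding wz by (rule sum_words_cong[where \<theta> = \<theta>, OF finite_block[OF U] block_subset[OF U] p(1) comm])
      moreover have "[D * z ^ p = D * z] (mod int p)"
        using fermat_int[OF p(1), of z] by (rule cong_scalar_left)
      ultimately have "[(\<Sum>x\<in>U. \<theta> (x [^] p)) = (\<Sum>x\<in>U. \<theta> x)] (mod int p)"
        unfolding Dz by (meson cong_sym cong_trans)
      then have dvd: "int p dvd (\<Sum>x\<in>U. \<theta> (x [^] p)) - (\<Sum>x\<in>U. \<theta> x)"
        by (simp add: cong_iff_dvd_diff)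
      have cX: "int (card U) \<le> int (order G)"
        unfolding Coset.order_def using card_mono[OF fin block_subset[OF U]] by simp
      have bound: "\<bar>\<Sum>x\<in>U. \<theta> (f x)\<bar> \<le> int (order G) * M" if "\<And>x. x \<in> U \<Longrightarrow> f x \<in> carrier G" for f
      proof -
        have "\<bar>\<Sum>x\<in>U. \<theta> (f x)\<bar> \<le> (\<Sum>x\<in>U. \<bar>\<theta> (f x)\<bar>)" by (rule sum_abs)
        moreover have "(\<Sum>x\<in>U. \<bar>\<theta> (f x)\<bar>) \<le> (\<Sum>x\<in>U. M)" using that M by (intro sum_mono) auto
        moreover have "(\<Sum>x\<in>U. M) \<le> int (order G) * M" using cX M0 by (simp add: mult_right_mono)
        ultimately show ?thesis by linarith
      qed
      have "\<bar>\<Sum>x\<in>U. \<theta> (x [^] p)\<bar> \<le> int (order G) * M" "\<bar>\<Sum>x\<in>U. \<theta> x\<bar> \<le> int (order G) * M"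
        using bound[of "\<lambda>x. x [^] p"] bound[of "\<lambda>x. x"] UG by auto
      moreover have "2 * (int (order G) * M) < int p" using p(2) by (simp add: B_def)
      ultimately have "\<bar>(\<Sum>x\<in>U. \<theta> (x [^] p)) - (\<Sum>x\<in>U. \<theta> x)\<bar> < int p" by linarith
      then have "(\<Sum>x\<in>U. \<theta> (x [^] p)) - (\<Sum>x\<in>U. \<theta> x) = 0"
        using dvd_imp_le_int[OF _ dvd] by linarith
      then show ?thesis by simp
    qed
    \<comment> \<open>The factor \<open>\<theta> x\<close> is constant on each basic set and can be
      pulled out, so equality of the sums over basic sets is enough for the cross term.\<close>
    have "(\<Sum>x\<in>carrier G. \<theta> (x [^] p) * \<theta> x) = (\<Sum>x\<in>carrier G. \<theta> x * \<theta> x)"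
      unfolding sum_carrier_blocks
    proof (rule sum.cong[OF refl])
      fix Y assume Y: "Y \<in> S"
      obtain y where y: "y \<in> Y" using block_nonempty[OF Y] by auto
      have const: "\<theta> x = \<theta> y" if "x \<in> Y" for x
        using that y Y block_subset[OF Y] by (subst \<theta>_eq) (auto simp: sph_block[OF Y])
      have "(\<Sum>x\<in>Y. \<theta> (x [^] p) * \<theta> x) = (\<Sum>x\<in>Y. \<theta> (x [^] p)) * \<theta> y"
        unfolding sum_distrib_right by (rule sum.cong) (auto dest: const)
      also have "\<dots> = (\<Sum>x\<in>Y. \<theta> x * \<theta> x)"
        unfolding block[OF Y] sum_distrib_right by (rule sum.cong) (auto dest: const)
      finally show "(\<Sum>x\<in>Y. \<theta> (x [^] p) * \<theta> x) = (\<Sum>x\<in>Y. \<theta> x * \<theta> x)" .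
    qed
    moreover have "(\<Sum>x\<in>carrier G. \<theta> (x [^] p) * \<theta> (x [^] p)) = (\<Sum>x\<in>carrier G. \<theta> x * \<theta> x)"
    proof -
      have "order G > 0" by (simp add: fin order_gt_0_iff_finite)
      then have "\<not> p dvd order G" using p(2) by (auto simp: B_def dest: dvd_imp_le)
      then have "coprime p (order G)" using p(1) by (simp add: prime_imp_coprime)
      then show ?thesis by (rule sum.reindex_bij_betw[OF pow_coprime_bij[OF fin]])
    qed
    moreover have "(\<Sum>x\<in>carrier G. (\<theta> (x [^] p) - \<theta> x)\<^sup>2) =
        (\<Sum>x\<in>carrier G. \<theta> (x [^] p) * \<theta> (x [^] p)) - 2 * (\<Sum>x\<in>carrier G. \<theta> (x [^] p) * \<theta> x)
          + (\<Sum>x\<in>carrier G. \<theta> x * \<theta> x)"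
      by (simp add: power2_eq_square algebra_simps sum.distrib sum_subtractf sum_distrib_left)
    ultimately have "(\<Sum>x\<in>carrier G. (\<theta> (x [^] p) - \<theta> x)\<^sup>2) = 0" by simp
    then have "(\<theta> (y [^] p) - \<theta> y)\<^sup>2 = 0" using y fin by (subst (asm) sum_nonneg_eq_0_iff) auto
    then show ?thesis using y by (simp add: \<theta>_eq)
  qed
  then show ?thesis by (rule that)
qed

text \<open>Only the class of \<open>m\<close> modulo the group order matters. A representative
  whose prime factors all exceed \<open>B\<close> makes the power map a composition of large prime
  powers.\<close>

lemma sph_coprime_power:
  assumes rat: "\<And>w. w \<in> carrier G \<Longrightarrow> sph w \<in> \<rat>"
    and m: "coprime m (order G)" and x: "x \<in> carrier G"
  shows "sph (x [^] (m :: nat)) = sph x"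
proof -
  obtain B where B: "\<And>p x. prime p \<Longrightarrow> p > B \<Longrightarrow> x \<in> carrier G \<Longrightarrow> sph (x [^] (p :: nat)) = sph x"
    using sph_large_prime_power[OF rat] by blast
  have pow: "sph (y [^] k) = sph y"
    if "k > 0" "\<And>p. prime p \<Longrightarrow> p dvd k \<Longrightarrow> p > B" "y \<in> carrier G" for k :: nat and y
    using that
  proof (induction k arbitrary: y rule: less_induct)
    case (less k)
    show ?case
    proof (cases "k = 1")
      case False
      then obtain p where p: "prime p" "p dvd k" using prime_factor_nat by blast
      then obtain l where l: "k = p * l" by auto
      have "l < k" using l p(1) less.prems(1) prime_gt_1_nat[OF p(1)] by simp
      then have "sph ((y [^] p) [^] l) = sph (y [^] p)"
        using less.prems l by (intro less.IH) auto
      then show ?thesis using l p less.prems B by (simp add: nat_pow_pow)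
    qed (use less.prems in simp)
  qed
  have n: "order G > 0" by (simp add: fin order_gt_0_iff_finite)
  obtain k where k: "k > 0" "[k = m] (mod order G)" "\<And>p. prime p \<Longrightarrow> p dvd k \<Longrightarrow> p > B"
    using coprime_lift_large_primes[OF n m] by metis
  have "[k = m] (mod ord x)" using k(2) ord_dvd_group_order[OF x] by (rule cong_dvd_modulus_nat)
  then have "x [^] k = x [^] m" by (rule pow_cong_ord[OF x])
  then show ?thesis using pow[OF k(1,3) x] by simp
qed

end

section \<open>Characters separate the elements of an S-ring\<close>

context central_S_ring
begin

text \<open>Left translation extended linearly to the group ring; the order of factors is reversed
  under products. The value 0 outside the group makes functions in the range determined by their
  values on the group, so that they lie in a finite-dimensional space.\<close>

definition trans_op :: "('a \<Rightarrow> int) \<Rightarrow> ('a \<Rightarrow> complex) \<Rightarrow> 'a \<Rightarrow> complex" where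
  "trans_op a f = (\<lambda>w. if w \<in> carrier G then \<Sum>x\<in>carrier G. of_int (a x) * f (x \<otimes> w) else 0)"

lemma trans_op_linear: "linear_operator (trans_op a)"
  by unfold_locales (auto simp: trans_op_def fun_eq_iff sum.distrib sum_distrib_left algebra_simps)

lemma trans_op_add: "trans_op (\<lambda>z. a z + b z) f = (\<lambda>w. trans_op a f w + trans_op b f w)"
  by (auto simp: trans_op_def fun_eq_iff sum.distrib algebra_simps)

lemma trans_op_mult: "trans_op (gr_mult G a b) f = trans_op b (trans_op a f)"
proof
  fix w
  show "trans_op (gr_mult G a b) f w = trans_op b (trans_op a f) w"
  proof (cases "w \<in> carrier G")
    case True
    have "trans_op (gr_mult G a b) f w =
        (\<Sum>z\<in>carrier G. \<Sum>x\<in>carrier G. of_int (a x) * of_int (b (inv x \<otimes> z)) * f (z \<otimes> w))"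
      using True by (simp add: trans_op_def gr_mult_def sum_distrib_right)
    also have "\<dots> = (\<Sum>x\<in>carrier G. \<Sum>z\<in>carrier G. of_int (a x) * of_int (b (inv x \<otimes> z)) * f (z \<otimes> w))"
      by (rule sum.swap)
    also have "\<dots> = (\<Sum>x\<in>carrier G. \<Sum>y\<in>carrier G. of_int (a x) * of_int (b y) * f (x \<otimes> y \<otimes> w))"
    proof (rule sum.cong[OF refl])
      fix x assume x: "x \<in> carrier G"
      show "(\<Sum>z\<in>carrier G. of_int (a x) * of_int (b (inv x \<otimes> z)) * f (z \<otimes> w)) =
          (\<Sum>y\<in>carrier G. of_int (a x) * of_int (b y) * f (x \<otimes> y \<otimes> w))"
        using x by (subst sum_carrier_mult_left[of x, symmetric])
          (auto simp: m_assoc[symmetric] intro!: sum.cong)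
    qed
    also have "\<dots> = (\<Sum>y\<in>carrier G. \<Sum>x\<in>carrier G. of_int (a x) * of_int (b y) * f (x \<otimes> y \<otimes> w))"
      by (rule sum.swap)
    also have "\<dots> = trans_op b (trans_op a f) w"
      using True by (simp add: trans_op_def sum_distrib_left m_assoc mult_ac)
    finally show ?thesis .
  qed (simp add: trans_op_def)
qed

lemma trans_op_commute:
  "a \<in> zspan S \<Longrightarrow> b \<in> zspan S \<Longrightarrow> trans_op a (trans_op b f) = trans_op b (trans_op a f)"
  using gr_mult_commute[of a b] by (simp flip: trans_op_mult)

lemma trans_op_combination:
  "trans_op (\<lambda>z. \<Sum>Y\<in>S. c Y * ul Y z) f = (\<lambda>w. \<Sum>Y\<in>S. of_int (c Y) * trans_op (ul Y) f w)"
proof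
  fix w
  have "(\<Sum>x\<in>carrier G. \<Sum>Y\<in>S. of_int (c Y) * (of_int (ul Y x) * f (x \<otimes> w))) =
      (\<Sum>Y\<in>S. \<Sum>x\<in>carrier G. of_int (c Y) * (of_int (ul Y x) * f (x \<otimes> w)))"
    by (rule sum.swap)
  then show "trans_op (\<lambda>z. \<Sum>Y\<in>S. c Y * ul Y z) f w = (\<Sum>Y\<in>S. of_int (c Y) * trans_op (ul Y) f w)"
    by (simp add: trans_op_def sum_distrib_left sum_distrib_right mult.assoc)
qed

definition herm :: "('a \<Rightarrow> complex) \<Rightarrow> ('a \<Rightarrow> complex) \<Rightarrow> complex" where
  "herm f g = (\<Sum>x\<in>carrier G. f x * cnj (g x))"

lemma herm_cnj: "cnj (herm f g) = herm g f"
  by (simp add: herm_def mult.commute)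

lemma herm_zero_right: "herm f (\<lambda>x. 0) = 0"
  by (simp add: herm_def)

lemma herm_definite:
  assumes "herm f f = 0" and "\<And>x. x \<notin> carrier G \<Longrightarrow> f x = 0"
  shows "f = (\<lambda>x. 0)"
proof
  have "herm f f = of_real (\<Sum>x\<in>carrier G. (cmod (f x))\<^sup>2)"
    by (simp add: herm_def complex_norm_square[symmetric])
  then have "(\<Sum>x\<in>carrier G. (cmod (f x))\<^sup>2) = 0" using assms(1) by (metis of_real_eq_0_iff)
  then have "\<forall>x\<in>carrier G. (cmod (f x))\<^sup>2 = 0" using fin by (subst (asm) sum_nonneg_eq_0_iff) auto
  then show "f x = 0" for x using assms(2) by (cases "x \<in> carrier G") auto
qed

text \<open>Translation by \<open>x\<close> is unitary with adjoint translation by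
  \<open>inv x\<close>, and the integer coefficients are fixed by conjugation.\<close>

lemma herm_adjoint: "herm (trans_op a f) g = herm f (trans_op (star a) g)"
proof -
  have "herm (trans_op a f) g = (\<Sum>w\<in>carrier G. \<Sum>x\<in>carrier G. of_int (a x) * f (x \<otimes> w) * cnj (g w))"
    by (simp add: herm_def trans_op_def sum_distrib_right)
  also have "\<dots> = (\<Sum>x\<in>carrier G. \<Sum>w\<in>carrier G. of_int (a x) * f (x \<otimes> w) * cnj (g w))"
    by (rule sum.swap)
  also have "\<dots> = (\<Sum>x\<in>carrier G. \<Sum>w\<in>carrier G. of_int (a x) * f w * cnj (g (inv x \<otimes> w)))"
  proof (rule sum.cong[OF refl])
    fix x assume x: "x \<in> carrier G"
    show "(\<Sum>w\<in>carrier G. of_int (a x) * f (x \<otimes> w) * cnj (g w)) =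
        (\<Sum>w\<in>carrier G. of_int (a x) * f w * cnj (g (inv x \<otimes> w)))"
      using x by (subst sum_carrier_mult_left[of "inv x", symmetric])
        (auto simp: m_assoc[symmetric] intro!: sum.cong)
  qed
  also have "\<dots> = (\<Sum>x\<in>carrier G. \<Sum>w\<in>carrier G. of_int (star a x) * f w * cnj (g (x \<otimes> w)))"
    by (subst sum_carrier_inv[symmetric]) (simp add: star_def)
  also have "\<dots> = (\<Sum>w\<in>carrier G. \<Sum>x\<in>carrier G. of_int (star a x) * f w * cnj (g (x \<otimes> w)))"
    by (rule sum.swap)
  also have "\<dots> = herm f (trans_op (star a) g)"
    by (simp add: herm_def trans_op_def sum_distrib_left mult_ac)
  finally show ?thesis .
qed

text \<open>Translation operators are normal, hence have no generalised null vectors.\<close>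

lemma trans_op_square_zero:
  assumes a: "a \<in> zspan S" and zero: "trans_op a (trans_op a f) = (\<lambda>x. 0)"
  shows "trans_op a f = (\<lambda>x. 0)"
proof -
  define b where "b = star a"
  have b: "b \<in> zspan S" unfolding b_def using a by (rule star_zspan)
  have adj: "herm (trans_op b g) h = herm g (trans_op a h)" for g h
    using herm_adjoint[of a h g] herm_cnj by (metis b_def)
  \<comment> \<open>Write A for the operator of \<open>a\<close> and B for its adjoint, so u = BAf.
    Commutation gives Au = BAAf = 0, hence <u, u> = <Af, Au> = 0 and u = 0. Then <Af, Af> = <f, u> =
    0.\<close>
  define u where "u = trans_op b (trans_op a f)"
  have "trans_op a u = trans_op b (trans_op a (trans_op a f))"
    unfolding u_def by (rule trans_op_commute[OF a b])
  also have "\<dots> = (\<lambda>x. 0)" unfolding zero by (rule linear_operator.zero[OF trans_op_linear])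
  finally have au: "trans_op a u = (\<lambda>x. 0)" .
  have "herm u u = herm (trans_op a f) (trans_op a u)" unfolding u_def by (rule adj)
  then have "herm u u = 0" unfolding au by (simp only: herm_zero_right)
  then have "u = (\<lambda>x. 0)" by (rule herm_definite) (simp add: u_def trans_op_def)
  then have "herm (trans_op a f) (trans_op a f) = 0"
    using herm_adjoint[of a f "trans_op a f"] by (simp add: u_def b_def herm_zero_right)
  then show ?thesis by (rule herm_definite) (simp add: trans_op_def)
qed

text \<open>Any common eigenvector of the translation operators defines a character. Searching for
  it inside the range of \<open>a\<close> guarantees that the eigenvalue of \<open>a\<close> is
  nonzero.\<close>

lemma characters_separate:
  assumes a: "a \<in> zspan S" "a \<noteq> (\<lambda>z. 0)"
  obtains \<pi> where "\<pi> \<in> Irr G S" "\<pi> a \<noteq> 0"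
proof -
  define V where "V = range (trans_op a)"
  interpret Ta: linear_operator "trans_op a" by (rule trans_op_linear)
  have V: "function_subspace V"
  proof
    show "(\<lambda>x. f x + g x) \<in> V" if "f \<in> V" "g \<in> V" for f g
      using that unfolding V_def by (auto simp flip: Ta.add)
    show "(\<lambda>x. c * f x) \<in> V" if "f \<in> V" for f c
      using that unfolding V_def by (auto simp flip: Ta.scale)
    show "(\<lambda>x. 0) \<in> V" unfolding V_def using Ta.zero by (intro range_eqI) (rule sym)
  qed
  \<comment> \<open>The point mass at the identity recovers the coefficients of \<open>a\<close>:
    its translate takes the value \<open>a z\<close> at \<open>inv z\<close>, so the range
    \<open>V\<close> is nonzero.\<close>
  define \<delta> :: "'a \<Rightarrow> complex" where "\<delta> = (\<lambda>x. if x = \<one> then 1 else 0)"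
  obtain z where z: "a z \<noteq> 0" using a(2) by auto
  then have zG: "z \<in> carrier G" using zspan_outside[OF a(1)] by auto
  have "trans_op a \<delta> (inv z) = (\<Sum>x\<in>carrier G. if x = z then of_int (a z) else 0)"
  proof -
    have "x \<otimes> inv z = \<one> \<longleftrightarrow> x = z" if "x \<in> carrier G" for x
      using that zG by (metis inv_equality inv_inv r_inv inv_closed)
    then show ?thesis using zG by (auto simp: trans_op_def \<delta>_def intro!: sum.cong)
  qed
  then have "trans_op a \<delta> (inv z) \<noteq> 0" using zG z fin by simp
  then have nz: "trans_op a \<delta> \<noteq> (\<lambda>x. 0)" by metis
  have "\<exists>g\<in>V. g \<noteq> (\<lambda>x. 0) \<and> (\<forall>Y\<in>S. \<exists>\<mu>. trans_op (ul Y) g = (\<lambda>x. \<mu> * g x))"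
  proof (rule common_eigenvector[of S "\<lambda>Y. trans_op (ul Y)" V "carrier G" "trans_op a \<delta>"])
    show "trans_op (ul Y) f \<in> V" if "Y \<in> S" "f \<in> V" for Y f
      using that trans_op_commute[OF ul_zspan[OF that(1)] a(1)] unfolding V_def by auto
    show "trans_op (ul Y) (trans_op (ul Z) f) = trans_op (ul Z) (trans_op (ul Y) f)"
      if "Y \<in> S" "Z \<in> S" for Y Z f
      using that by (intro trans_op_commute ul_zspan)
    show "f x = 0" if "f \<in> V" "x \<notin> carrier G" for f x
      using that by (auto simp: V_def trans_op_def)
  qed (use finite_S trans_op_linear V fin nz in \<open>auto simp: V_def\<close>)
  then obtain g \<mu> where g: "g \<in> V" "g \<noteq> (\<lambda>x. 0)"
    and \<mu>: "\<And>Y. Y \<in> S \<Longrightarrow> trans_op (ul Y) g = (\<lambda>x. \<mu> Y * g x)"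
    by metis
  obtain w where w: "g w \<noteq> 0" using g(2) by auto
  \<comment> \<open>The eigenvalue is read off at a point where \<open>g\<close> does not vanish.
    For \<open>b\<close> outside the S-ring this is an arbitrary value, which \<open>Irr\<close>
    permits.\<close>
  define \<pi> where "\<pi> b = trans_op b g w / g w" for b
  have eig: "trans_op b g = (\<lambda>x. \<pi> b * g x)" if b: "b \<in> zspan S" for b
  proof -
    obtain c where c: "b = (\<lambda>z. \<Sum>Y\<in>S. c Y * ul Y z)" using b by (auto simp: zspan_def)
    have "trans_op b g = (\<lambda>x. (\<Sum>Y\<in>S. of_int (c Y) * \<mu> Y) * g x)"
      unfolding c trans_op_combination by (simp add: \<mu> sum_distrib_right mult.assoc)
    then show ?thesis using w by (simp add: \<pi>_def)
  qed
  have "\<pi> a \<noteq> 0"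
  proof
    assume "\<pi> a = 0"
    \<comment> \<open>Eigenvalue 0 would make \<open>h\<close> a vector killed by the square of the
      operator of \<open>a\<close> but not by the operator itself, which normality forbids.\<close>
    obtain h where h: "g = trans_op a h" using g(1) by (auto simp: V_def)
    have "trans_op a g = (\<lambda>x. 0)" using eig[OF a(1)] \<open>\<pi> a = 0\<close> by simp
    then have "g = (\<lambda>x. 0)" using trans_op_square_zero[OF a(1)] by (simp add: h)
    then show False using g(2) by simp
  qed
  moreover have "\<pi> \<in> Irr G S"
    unfolding Irr_def mem_Collect_eq
  proof (intro conjI ballI)
    fix b c assume b: "b \<in> zspan S" and c: "c \<in> zspan S"
    show "\<pi> (\<lambda>z. b z + c z) = \<pi> b + \<pi> c" by (simp add: \<pi>_def trans_op_add add_divide_distrib)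
    interpret Tc: linear_operator "trans_op c" by (rule trans_op_linear)
    have "trans_op (gr_mult G b c) g = (\<lambda>x. \<pi> b * trans_op c g x)"
      unfolding trans_op_mult eig[OF b] by (rule Tc.scale)
    then show "\<pi> (gr_mult G b c) = \<pi> b * \<pi> c" by (simp add: \<pi>_def[of "gr_mult G b c"] \<pi>_def[of c])
  qed (use a \<open>\<pi> a \<noteq> 0\<close> in auto)
  ultimately show ?thesis using that by blast
qed

section \<open>The two implications\<close>

lemma power_invariant_imp_rational:
  assumes rat: "rational_Sring G S" and \<pi>: "\<pi> \<in> Irr G S" and Y: "Y \<in> S"
  shows "\<pi> (ul Y) \<in> \<rat>"
proof -
  interpret S_ring_character G S \<pi> by unfold_locales (rule \<pi>)
  have "sph (x [^] m) = sph x" if x: "x \<in> carrier G" and m: "coprime m (order G)" for x and m :: nat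
  proof -
    obtain Z where Z: "Z \<in> S" "x \<in> Z" using block_exists x by auto
    have "coprime (int m) (int (order G))" using m by simp
    then have "(\<lambda>x. x [^] int m) ` Z = Z" using rat Z(1) unfolding rational_Sring_def by blast
    then have "x [^] m \<in> Z" using Z(2) by (auto simp: int_pow_int)
    then show ?thesis using Z by (simp add: sph_block)
  qed
  then have "sph y \<in> \<rat>" if "y \<in> carrier G" for y using sph_rational that by blast
  then show ?thesis unfolding pi_ul[OF Y, symmetric] using block_subset[OF Y] by (intro sum_rational) auto
qed

lemma rational_imp_power_invariant:
  assumes rat: "\<And>\<pi> Y. \<pi> \<in> Irr G S \<Longrightarrow> Y \<in> S \<Longrightarrow> \<pi> (ul Y) \<in> \<rat>"
  shows "rational_Sring G S"
  unfolding rational_Sring_def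
proof (intro ballI allI impI)
  fix Y and m :: int assume Y: "Y \<in> S" and m: "coprime m (int (order G))"
  have n: "order G > 0" by (simp add: fin order_gt_0_iff_finite)
  \<comment> \<open>Negative exponents are replaced by their residues modulo the group order, where
    the results about natural exponents apply.\<close>
  define k where "k = nat (m mod int (order G))"
  have k: "int k = m mod int (order G)" using n by (simp add: k_def)
  have "coprime (int k) (int (order G))" using m n unfolding k by simp
  then have cop: "coprime k (order G)" by simp
  have pow: "x [^] m = x [^] k" if x: "x \<in> carrier G" for x
  proof -
    have "x [^] m = x [^] (int (order G) * (m div int (order G)) + int k)" unfolding k by simp
    also have "\<dots> = (x [^] int (order G)) [^] (m div int (order G)) \<otimes> x [^] int k"
      using x by (simp only: int_pow_mult int_pow_pow)
    finally show ?thesis using x by (simp add: int_pow_int pow_order_eq_1)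
  qed
  have "x [^] k \<in> Y" if x: "x \<in> Y" for x
  proof -
    have xG: "x \<in> carrier G" using x block_subset[OF Y] by auto
    then obtain Z where Z: "Z \<in> S" "x [^] k \<in> Z" using block_exists[of "x [^] k"] by auto
    have "Z = Y"
    proof (rule ccontr)
      assume ne: "Z \<noteq> Y"
      \<comment> \<open>Weighted by the opposite cardinalities, the two basic sets cancel under any
        \<open>\<pi>\<close> whose \<open>sph\<close> agrees on \<open>Y\<close> and
        \<open>Z\<close>. If they were different, \<open>a\<close> would be nonzero yet annihilated
        by every character.\<close>
      define a where "a = (\<lambda>z. int (card Z) * ul Y z + - int (card Y) * ul Z z)"
      have a: "a \<in> zspan S" unfolding a_def using Y Z(1) by (intro zspan_add zspan_scale ul_zspan)
      have "x \<notin> Z" using block_unique[OF Y Z(1) x] ne by auto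
      then have "a x \<noteq> 0" using x card_block_pos[OF Z(1)] by (simp add: a_def ul_def)
      then have "a \<noteq> (\<lambda>z. 0)" by metis
      then obtain \<pi> where \<pi>: "\<pi> \<in> Irr G S" "\<pi> a \<noteq> 0" using characters_separate[OF a] by blast
      interpret S_ring_character G S \<pi> by unfold_locales (rule \<pi>)
      have "sph w \<in> \<rat>" if w: "w \<in> carrier G" for w
      proof -
        obtain W where W: "W \<in> S" "w \<in> W" using block_exists w by auto
        show ?thesis unfolding sph_block[OF W] using rat[OF \<pi>(1) W(1)] by (rule Rats_divide) simp
      qed
      then have "sph (x [^] k) = sph x" using cop xG by (rule sph_coprime_power)
      then have "of_nat (card Z) * \<pi> (ul Y) = of_nat (card Y) * \<pi> (ul Z)"
        using sph_block[OF Y x] sph_block[OF Z] card_block_pos[OF Y] card_block_pos[OF Z(1)]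
        by (simp add: field_simps)
      moreover have "\<pi> a = of_int (int (card Z)) * \<pi> (ul Y) + of_int (- int (card Y)) * \<pi> (ul Z)"
        unfolding a_def using Y Z(1) by (simp only: pi_add zspan_scale ul_zspan pi_scale)
      ultimately show False using \<pi>(2) by simp
    qed
    then show ?thesis using Z by simp
  qed
  then have "(\<lambda>x. x [^] k) ` Y \<subseteq> Y" by auto
  \<comment> \<open>Membership of powers in \<open>Y\<close> gives only an inclusion; injectivity on
    the finite set \<open>Y\<close> turns it into equality.\<close>
  moreover have "inj_on (\<lambda>x. x [^] k) Y"
    using pow_coprime_bij[OF fin cop] block_subset[OF Y] by (meson bij_betw_imp_inj_on inj_on_subset)
  ultimately have "(\<lambda>x. x [^] k) ` Y = Y" using endo_inj_surj[OF finite_block[OF Y]] by blast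
  moreover have "(\<lambda>x. x [^] m) ` Y = (\<lambda>x. x [^] k) ` Y"
    using pow block_subset[OF Y] by (intro image_cong) auto
  ultimately show "(\<lambda>x. x [^] m) ` Y = Y" by simp
qed

end

theorem theorem3p3:
  fixes G :: "('a, 'b) monoid_scheme" and S :: "'a set set"
  assumes "group G" and "finite (carrier G)"
    and "S_ring G S" and "central G S"
  shows "rational_Sring G S \<longleftrightarrow>
           (\<forall>\<pi>\<in>Irr G S. \<forall>Y\<in>S. \<pi> (ul Y) \<in> \<rat>)"
proof -
  interpret central_S_ring G S
    using assms by (simp add: central_S_ring_def central_S_ring_axioms_def)
  show ?thesis using power_invariant_imp_rational rational_imp_power_invariant by blast
qed

end
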